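(* Let $\mathcal{C}$ be a congruence-modular equational class, let $A,B$ be algebras from $\mathcal{C}$ and let $f:A\to B$ be a morphism in $\mathcal{C}$. For each $\theta\in\mathrm{Con}(A)$, let $f_{[\theta]}:A/\theta\to B/Cg_B(f(\theta))$ be the morphism given by $f_{[\theta]}(a/\theta)=f(a)/Cg_B(f(\theta))$ for all $a\in A$. If $f$ is admissible, then the following are equivalent: (1) $f$ fulfills LO; (2) for all $\theta\in\mathrm{Con}(A)$, $f_{[\theta]}$ fulfills LO; (3) $f_{[\mathrm{Ker}(f)]}$ fulfills LO.
   Context: An equational class (variety) $\mathcal{C}$ of algebras of a fixed type is congruence-modular if the congruence lattice $\mathrm{Con}(M)$ is modular for every member $M$ of $\mathcal{C}$. All algebras are non-empty; a morphism in $\mathcal{C}$ is a homomorphism between members of $\mathcal{C}$. For an algebra $M$, $\Delta_M$ is the equality relation and $\nabla_M=M^2$; for $X\subseteq M^2$, $Cg_M(X)$ is the congruence of $M$ generated by $X$. In a congruence-modular class, the commutator $[\alpha,\beta]_M$ of $\alpha,\beta\in\mathrm{Con}(M)$ is the (Freese--McKenzie) modular commutator, i.e. the smallest congruence $\delta$ of $M$ such that, for every term $t(\bar x,\bar y)$ and all tuples $\bar a,\bar b,\bar c,\bar d$ of elements of $M$ with $(a_i,b_i)\in\alpha$ for all $i$ and $(c_j,d_j)\in\beta$ for all $j$, $(t(\bar a,\bar c),t(\bar a,\bar d))\in\delta$ implies $(t(\bar b,\bar c),t(\bar b,\bar d))\in\delta$. A congruence $\phi\neq\nabla_M$ is prime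 if, for all $\alpha,\beta\in\mathrm{Con}(M)$, $[\alpha,\beta]_M\subseteq\phi$ implies $\alpha\subseteq\phi$ or $\beta\subseteq\phi$; $\mathrm{Spec}(M)$ is the set of prime congruences of $M$. For a morphism $f:A\to B$, $\theta\in\mathrm{Con}(A)$ and $\psi\in\mathrm{Con}(B)$: $f(\theta)=\{(f(a),f(b)) : (a,b)\in\theta\}\subseteq B^2$, $f^*(\psi)=\{(x,y)\in A^2 : (f(x),f(y))\in\psi\}\in\mathrm{Con}(A)$ and $\mathrm{Ker}(f)=f^*(\Delta_B)$. $f$ is admissible if $f^*(\psi)\in\mathrm{Spec}(A)$ for all $\psi\in\mathrm{Spec}(B)$; if $f$ is admissible, then so is every $f_{[\theta]}$. An admissible morphism $f:A\to B$ fulfills LO (Lying Over) if for every $\phi\in\mathrm{Spec}(A)$ with $\mathrm{Ker}(f)\subseteq\phi$ there is $\phi_1\in\mathrm{Spec}(B)$ with $f^*(\phi_1)=\phi$. *)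

theory Defs
  imports Main
begin

section \<open>Algebras, terms, equational classes\<close>

text \<open>A type of algebras is a partial arity function, so that the set of operation symbols may be
  any set, the empty one included.\<close>

type_synonym 's signature = "'s \<rightharpoonup> nat"

record ('s, 'a) algebra =
  carrier :: "'a set"
  oper :: "'s \<Rightarrow> 'a list \<Rightarrow> 'a"

definition is_algebra :: "'s signature \<Rightarrow> ('s, 'a) algebra \<Rightarrow> bool" where
  "is_algebra \<tau> M \<longleftrightarrow> carrier M \<noteq> {} \<and>
     (\<forall>g xs. \<tau> g = Some (length xs) \<longrightarrow> set xs \<subseteq> carrier M \<longrightarrow> oper M g xs \<in> carrier M)"

definition hom :: "'s signature \<Rightarrow> ('s, 'a) algebra \<Rightarrow> ('s, 'b) algebra \<Rightarrow> ('a \<Rightarrow> 'b) set" where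
  "hom \<tau> A B = {f. f ` carrier A \<subseteq> carrier B \<and>
     (\<forall>g xs. \<tau> g = Some (length xs) \<longrightarrow> set xs \<subseteq> carrier A \<longrightarrow>
        f (oper A g xs) = oper B g (map f xs))}"

datatype ('s, 'v) trm = Var 'v | App 's "('s, 'v) trm list"

fun wf_trm :: "'s signature \<Rightarrow> ('s, 'v) trm \<Rightarrow> bool" where
  "wf_trm \<tau> (Var x) = True"
| "wf_trm \<tau> (App g ts) = (\<tau> g = Some (length ts) \<and> (\<forall>t\<in>set ts. wf_trm \<tau> t))"

primrec eval :: "('s, 'a) algebra \<Rightarrow> ('v \<Rightarrow> 'a) \<Rightarrow> ('s, 'v) trm \<Rightarrow> 'a" where
  "eval M v (Var x) = v x"
| "eval M v (App g ts) = oper M g (map (eval M v) ts)"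

type_synonym 's equations = "(('s, nat) trm \<times> ('s, nat) trm) set"

definition wf_equations :: "'s signature \<Rightarrow> 's equations \<Rightarrow> bool" where
  "wf_equations \<tau> E \<longleftrightarrow> (\<forall>(s, t)\<in>E. wf_trm \<tau> s \<and> wf_trm \<tau> t)"

text \<open>The members, with elements in a given type, of the equational class axiomatized by \<open>E\<close>.\<close>

definition in_class :: "'s signature \<Rightarrow> 's equations \<Rightarrow> ('s, 'a) algebra \<Rightarrow> bool" where
  "in_class \<tau> E M \<longleftrightarrow> is_algebra \<tau> M \<and>
     (\<forall>(s, t)\<in>E. \<forall>v. range v \<subseteq> carrier M \<longrightarrow> eval M v s = eval M v t)"


section \<open>Congruences\<close>

definition Con :: "'s signature \<Rightarrow> ('s, 'a) algebra \<Rightarrow> 'a rel set" where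
  "Con \<tau> M = {\<theta>. equiv (carrier M) \<theta> \<and>
     (\<forall>g xs ys. \<tau> g = Some (length xs) \<longrightarrow> list_all2 (\<lambda>x y. (x, y) \<in> \<theta>) xs ys \<longrightarrow>
        (oper M g xs, oper M g ys) \<in> \<theta>)}"

definition Cg :: "'s signature \<Rightarrow> ('s, 'a) algebra \<Rightarrow> 'a rel \<Rightarrow> 'a rel" where
  "Cg \<tau> M X = \<Inter>{\<theta> \<in> Con \<tau> M. X \<subseteq> \<theta>}"

definition Con_modular :: "'s signature \<Rightarrow> ('s, 'a) algebra \<Rightarrow> bool" where
  "Con_modular \<tau> M \<longleftrightarrow> (\<forall>\<alpha>\<in>Con \<tau> M. \<forall>\<beta>\<in>Con \<tau> M. \<forall>\<gamma>\<in>Con \<tau> M. \<alpha> \<subseteq> \<gamma> \<longrightarrow>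
     Cg \<tau> M (\<alpha> \<union> (\<beta> \<inter> \<gamma>)) = Cg \<tau> M (\<alpha> \<union> \<beta>) \<inter> \<gamma>)"

text \<open>A formula cannot quantify over all types, so the members of the class are taken here with
  elements in the single type \<open>('s, nat) trm\<close>, which has room for a copy of every countably
  generated algebra. Lemma \<open>congruence_modular_in_class\<close> below shows that nothing is lost: the
  condition then holds for the members of the class with elements in any type whatsoever.\<close>

definition congruence_modular :: "'s signature \<Rightarrow> 's equations \<Rightarrow> bool" where
  "congruence_modular \<tau> E \<longleftrightarrow>
     (\<forall>M :: ('s, ('s, nat) trm) algebra. in_class \<tau> E M \<longrightarrow> Con_modular \<tau> M)"


section \<open>Commutator and prime congruences\<close>

text \<open>In the term \<open>t\<close> the variables \<open>Inl i\<close> form the first tuple and the variables \<open>Inr j\<close> the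
  second one. Only finitely many of them occur in \<open>t\<close>, and by reflexivity of \<open>\<alpha>\<close> and \<open>\<beta>\<close> finite
  tuples extend to the sequences used here.\<close>

definition centralizes ::
  "'s signature \<Rightarrow> ('s, 'a) algebra \<Rightarrow> 'a rel \<Rightarrow> 'a rel \<Rightarrow> 'a rel \<Rightarrow> bool" where
  "centralizes \<tau> M \<alpha> \<beta> \<delta> \<longleftrightarrow>
     (\<forall>(t :: ('s, nat + nat) trm) a b c d. wf_trm \<tau> t \<longrightarrow>
        (\<forall>i. (a i, b i) \<in> \<alpha>) \<longrightarrow> (\<forall>j. (c j, d j) \<in> \<beta>) \<longrightarrow>
        (eval M (case_sum a c) t, eval M (case_sum a d) t) \<in> \<delta> \<longrightarrow>
        (eval M (case_sum b c) t, eval M (case_sum b d) t) \<in> \<delta>)"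

definition commutator ::
  "'s signature \<Rightarrow> ('s, 'a) algebra \<Rightarrow> 'a rel \<Rightarrow> 'a rel \<Rightarrow> 'a rel" where
  "commutator \<tau> M \<alpha> \<beta> = \<Inter>{\<delta> \<in> Con \<tau> M. centralizes \<tau> M \<alpha> \<beta> \<delta>}"

definition Spec :: "'s signature \<Rightarrow> ('s, 'a) algebra \<Rightarrow> 'a rel set" where
  "Spec \<tau> M = {\<phi> \<in> Con \<tau> M. \<phi> \<noteq> carrier M \<times> carrier M \<and>
     (\<forall>\<alpha>\<in>Con \<tau> M. \<forall>\<beta>\<in>Con \<tau> M. commutator \<tau> M \<alpha> \<beta> \<subseteq> \<phi> \<longrightarrow> \<alpha> \<subseteq> \<phi> \<or> \<beta> \<subseteq> \<phi>)}"


section \<open>Morphisms\<close>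

definition rel_image :: "('a \<Rightarrow> 'b) \<Rightarrow> 'a rel \<Rightarrow> 'b rel" where
  "rel_image f \<theta> = {(f a, f b) | a b. (a, b) \<in> \<theta>}"

definition pullback :: "('s, 'a) algebra \<Rightarrow> ('a \<Rightarrow> 'b) \<Rightarrow> 'b rel \<Rightarrow> 'a rel" where
  "pullback A f \<psi> = {(x, y) \<in> carrier A \<times> carrier A. (f x, f y) \<in> \<psi>}"

definition Ker :: "('s, 'a) algebra \<Rightarrow> ('s, 'b) algebra \<Rightarrow> ('a \<Rightarrow> 'b) \<Rightarrow> 'a rel" where
  "Ker A B f = pullback A f (Id_on (carrier B))"

definition admissible ::
  "'s signature \<Rightarrow> ('s, 'a) algebra \<Rightarrow> ('s, 'b) algebra \<Rightarrow> ('a \<Rightarrow> 'b) \<Rightarrow> bool" where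
  "admissible \<tau> A B f \<longleftrightarrow> (\<forall>\<psi>\<in>Spec \<tau> B. pullback A f \<psi> \<in> Spec \<tau> A)"

definition fulfills_LO ::
  "'s signature \<Rightarrow> ('s, 'a) algebra \<Rightarrow> ('s, 'b) algebra \<Rightarrow> ('a \<Rightarrow> 'b) \<Rightarrow> bool" where
  "fulfills_LO \<tau> A B f \<longleftrightarrow> admissible \<tau> A B f \<and>
     (\<forall>\<phi>\<in>Spec \<tau> A. Ker A B f \<subseteq> \<phi> \<longrightarrow> (\<exists>\<phi>\<^sub>1\<in>Spec \<tau> B. pullback A f \<phi>\<^sub>1 = \<phi>))"

text \<open>\<open>quotient_alg\<close> and \<open>induced\<close> avoid a choice of representatives by closing the set of all
  possible results under the congruence; the usual descriptions are \<open>oper_quotient_alg\<close> and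
  \<open>induced_class\<close>.\<close>

definition quotient_alg :: "('s, 'a) algebra \<Rightarrow> 'a rel \<Rightarrow> ('s, 'a set) algebra" where
  "quotient_alg M \<theta> =
     \<lparr>carrier = carrier M // \<theta>, oper = (\<lambda>g Xs. \<theta> `` (oper M g ` listset Xs))\<rparr>"

definition induced ::
  "'s signature \<Rightarrow> ('s, 'b) algebra \<Rightarrow> ('a \<Rightarrow> 'b) \<Rightarrow> 'a rel \<Rightarrow> 'a set \<Rightarrow> 'b set" where
  "induced \<tau> B f \<theta> X = Cg \<tau> B (rel_image f \<theta>) `` (f ` X)"


section \<open>Adequacy of the definitions\<close>

lemma ConD:
  assumes "\<theta> \<in> Con \<tau> M"
  shows "equiv (carrier M) \<theta>" "\<theta> \<subseteq> carrier M \<times> carrier M"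
    "x \<in> carrier M \<Longrightarrow> (x, x) \<in> \<theta>"
    "(x, y) \<in> \<theta> \<Longrightarrow> (y, x) \<in> \<theta>"
    "(x, y) \<in> \<theta> \<Longrightarrow> (y, z) \<in> \<theta> \<Longrightarrow> (x, z) \<in> \<theta>"
    "\<tau> g = Some (length xs) \<Longrightarrow> list_all2 (\<lambda>x y. (x, y) \<in> \<theta>) xs ys \<Longrightarrow>
       (oper M g xs, oper M g ys) \<in> \<theta>"
  using assms unfolding Con_def equiv_def refl_on_def sym_def trans_def by blast+

lemma ConI:
  assumes "\<theta> \<subseteq> carrier M \<times> carrier M"
    "\<And>x. x \<in> carrier M \<Longrightarrow> (x, x) \<in> \<theta>"
    "\<And>x y. (x, y) \<in> \<theta> \<Longrightarrow> (y, x) \<in> \<theta>"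
    "\<And>x y z. (x, y) \<in> \<theta> \<Longrightarrow> (y, z) \<in> \<theta> \<Longrightarrow> (x, z) \<in> \<theta>"
    "\<And>g xs ys. \<tau> g = Some (length xs) \<Longrightarrow> list_all2 (\<lambda>x y. (x, y) \<in> \<theta>) xs ys \<Longrightarrow>
       (oper M g xs, oper M g ys) \<in> \<theta>"
  shows "\<theta> \<in> Con \<tau> M"
  using assms unfolding Con_def equiv_def refl_on_def sym_def trans_def by blast

lemma list_all2_carrier:
  assumes "list_all2 (\<lambda>x y. (x, y) \<in> \<theta>) xs ys" "\<theta> \<subseteq> S \<times> S"
  shows "set xs \<subseteq> S" "set ys \<subseteq> S"
  using assms by (induction rule: list_all2_induct) auto

lemma Con_full: "is_algebra \<tau> M \<Longrightarrow> carrier M \<times> carrier M \<in> Con \<tau> M"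
proof (rule ConI)
  fix g xs ys
  assume M: "is_algebra \<tau> M" and g: "\<tau> g = Some (length xs)"
    and xy: "list_all2 (\<lambda>x y. (x, y) \<in> carrier M \<times> carrier M) xs ys"
  have "length xs = length ys"
    using xy by (rule list_all2_lengthD)
  then show "(oper M g xs, oper M g ys) \<in> carrier M \<times> carrier M"
    using M g list_all2_carrier[OF xy subset_refl] by (simp add: is_algebra_def)
qed auto

lemma Con_Inter:
  assumes "K \<subseteq> Con \<tau> M" "K \<noteq> {}"
  shows "\<Inter>K \<in> Con \<tau> M"
proof (rule ConI)
  have KC: "\<theta> \<in> Con \<tau> M" if "\<theta> \<in> K" for \<theta>
    using that assms(1) by (rule subsetD[rotated])
  obtain \<theta>\<^sub>0 where "\<theta>\<^sub>0 \<in> K"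
    using assms(2) by blast
  then show "\<Inter>K \<subseteq> carrier M \<times> carrier M"
    using ConD(2)[OF KC, of \<theta>\<^sub>0] by blast
  show "x \<in> carrier M \<Longrightarrow> (x, x) \<in> \<Inter>K" for x
    by (intro InterI ConD(3)[OF KC])
  show "(x, y) \<in> \<Inter>K \<Longrightarrow> (y, x) \<in> \<Inter>K" for x y
    using ConD(4)[OF KC] by simp
  show "(x, z) \<in> \<Inter>K" if "(x, y) \<in> \<Inter>K" "(y, z) \<in> \<Inter>K" for x y z
  proof
    fix \<theta> assume "\<theta> \<in> K"
    with that have "(x, y) \<in> \<theta>" "(y, z) \<in> \<theta>" by simp_all
    then show "(x, z) \<in> \<theta>" by (rule ConD(5)[OF KC[OF \<open>\<theta> \<in> K\<close>]])
  qed
  show "(oper M g xs, oper M g ys) \<in> \<Inter>K"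
    if "\<tau> g = Some (length xs)" "list_all2 (\<lambda>x y. (x, y) \<in> \<Inter>K) xs ys" for g xs ys
  proof
    fix \<theta> assume "\<theta> \<in> K"
    with that(2) have "list_all2 (\<lambda>x y. (x, y) \<in> \<theta>) xs ys"
      by (simp add: list_all2_conv_all_nth)
    then show "(oper M g xs, oper M g ys) \<in> \<theta>"
      by (rule ConD(6)[where \<tau> = \<tau>, OF KC[OF \<open>\<theta> \<in> K\<close>] that(1)])
  qed
qed

lemma Cg_Con:
  assumes "is_algebra \<tau> M" "X \<subseteq> carrier M \<times> carrier M"
  shows "Cg \<tau> M X \<in> Con \<tau> M"
  unfolding Cg_def using Con_full[OF assms(1)] assms(2) by (intro Con_Inter) auto

lemma Cg_upper: "X \<subseteq> Cg \<tau> M X"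
  by (auto simp: Cg_def)

lemma Cg_least: "\<theta> \<in> Con \<tau> M \<Longrightarrow> X \<subseteq> \<theta> \<Longrightarrow> Cg \<tau> M X \<subseteq> \<theta>"
  by (auto simp: Cg_def)

lemma eval_carrier:
  assumes "is_algebra \<tau> M" "range v \<subseteq> carrier M" "wf_trm \<tau> t"
  shows "eval M v t \<in> carrier M"
  using assms(3)
proof (induction t)
  case (App g ts)
  then show ?case
    using assms(1) by (auto simp: is_algebra_def image_subset_iff)
qed (use assms(2) in auto)

lemma commutator_least:
  fixes M :: "('s, 'a) algebra"
  assumes "is_algebra \<tau> M" "\<alpha> \<in> Con \<tau> M" "\<beta> \<in> Con \<tau> M"
  shows "commutator \<tau> M \<alpha> \<beta> \<in> Con \<tau> M"
    and "centralizes \<tau> M \<alpha> \<beta> (commutator \<tau> M \<alpha> \<beta>)"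
    and "\<delta> \<in> Con \<tau> M \<Longrightarrow> centralizes \<tau> M \<alpha> \<beta> \<delta> \<Longrightarrow> commutator \<tau> M \<alpha> \<beta> \<subseteq> \<delta>"
proof -
  have "centralizes \<tau> M \<alpha> \<beta> (carrier M \<times> carrier M)"
    unfolding centralizes_def
  proof (intro allI impI)
    fix t :: "('s, nat + nat) trm" and a b c d
    assume t: "wf_trm \<tau> t" and "\<forall>i::nat. (a i, b i) \<in> \<alpha>" "\<forall>j::nat. (c j, d j) \<in> \<beta>"
    then have *: "b i \<in> carrier M" "c j \<in> carrier M" "d j \<in> carrier M" for i j
      using ConD(2)[OF assms(2)] ConD(2)[OF assms(3)] by blast+
    have "range (case_sum b c) \<subseteq> carrier M" "range (case_sum b d) \<subseteq> carrier M"
      using * by (auto split: sum.splits)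
    then show "(eval M (case_sum b c) t, eval M (case_sum b d) t) \<in> carrier M \<times> carrier M"
      using eval_carrier[OF assms(1) _ t] by blast
  qed
  then show "commutator \<tau> M \<alpha> \<beta> \<in> Con \<tau> M"
    unfolding commutator_def using Con_full[OF assms(1)] by (intro Con_Inter) auto
  show "centralizes \<tau> M \<alpha> \<beta> (commutator \<tau> M \<alpha> \<beta>)"
    unfolding commutator_def centralizes_def by blast
  show "\<delta> \<in> Con \<tau> M \<Longrightarrow> centralizes \<tau> M \<alpha> \<beta> \<delta> \<Longrightarrow> commutator \<tau> M \<alpha> \<beta> \<subseteq> \<delta>"
    unfolding commutator_def by blast
qed

lemma mem_listset: "xs \<in> listset Xs \<longleftrightarrow> list_all2 (\<in>) xs Xs"
  by (induction Xs arbitrary: xs) (auto simp: set_Cons_def list_all2_Cons2)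

lemma oper_quotient_alg:
  assumes "\<theta> \<in> Con \<tau> M" "\<tau> g = Some (length xs)" "set xs \<subseteq> carrier M"
  shows "oper (quotient_alg M \<theta>) g (map (\<lambda>x. \<theta> `` {x}) xs) = \<theta> `` {oper M g xs}"
proof -
  have *: "ys \<in> listset (map (\<lambda>x. \<theta> `` {x}) xs) \<longleftrightarrow> list_all2 (\<lambda>x y. (x, y) \<in> \<theta>) xs ys" for ys
    by (auto simp: mem_listset list_all2_conv_all_nth)
  have "list_all2 (\<lambda>x y. (x, y) \<in> \<theta>) xs xs"
    using assms(3) ConD(3)[OF assms(1)] by (auto simp: list_all2_same)
  then have "\<theta> `` (oper M g ` listset (map (\<lambda>x. \<theta> `` {x}) xs)) = \<theta> `` {oper M g xs}"
    using * ConD(5,6)[OF assms(1)] assms(2) by (auto; blast)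
  then show ?thesis
    by (simp add: quotient_alg_def)
qed

lemma quotient_reps:
  assumes "set Xs \<subseteq> S // \<theta>"
  obtains xs where "set xs \<subseteq> S" "Xs = map (\<lambda>x. \<theta> `` {x}) xs"
proof -
  have "Xs \<in> lists ((\<lambda>x. \<theta> `` {x}) ` S)"
    using assms by (auto simp: quotient_def)
  then show thesis
    using that by (auto simp: lists_image)
qed

lemma is_algebra_quotient_alg:
  assumes "is_algebra \<tau> M" "\<theta> \<in> Con \<tau> M"
  shows "is_algebra \<tau> (quotient_alg M \<theta>)"
  unfolding is_algebra_def
proof (intro conjI allI impI)
  show "carrier (quotient_alg M \<theta>) \<noteq> {}"
    using assms(1) by (auto simp: quotient_alg_def is_algebra_def quotient_def)
  fix g Xs assume g: "\<tau> g = Some (length Xs)" and Xs: "set Xs \<subseteq> carrier (quotient_alg M \<theta>)"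
  from Xs obtain xs where xs: "set xs \<subseteq> carrier M" "Xs = map (\<lambda>x. \<theta> `` {x}) xs"
    by (auto simp: quotient_alg_def elim: quotient_reps)
  with g have "oper (quotient_alg M \<theta>) g Xs = \<theta> `` {oper M g xs}" "oper M g xs \<in> carrier M"
    using oper_quotient_alg[OF assms(2)] assms(1) by (auto simp: is_algebra_def)
  then show "oper (quotient_alg M \<theta>) g Xs \<in> carrier (quotient_alg M \<theta>)"
    by (auto simp: quotient_alg_def quotientI)
qed

lemma in_class_quotient_alg:
  assumes E: "wf_equations \<tau> E" and M: "in_class \<tau> E M" and \<theta>: "\<theta> \<in> Con \<tau> M"
  shows "in_class \<tau> E (quotient_alg M \<theta>)"
proof -
  have alg: "is_algebra \<tau> M"
    using M by (simp add: in_class_def)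
  have ev: "eval (quotient_alg M \<theta>) (\<lambda>n. \<theta> `` {w n}) t = \<theta> `` {eval M w t}"
    if "range w \<subseteq> carrier M" "wf_trm \<tau> t" for w and t :: "('a, nat) trm"
    using that(2)
  proof (induction t)
    case (App g ts)
    have "set (map (eval M w) ts) \<subseteq> carrier M"
      using App.prems that(1) eval_carrier[OF alg] by auto
    then have "oper (quotient_alg M \<theta>) g (map (\<lambda>x. \<theta> `` {x}) (map (eval M w) ts))
        = \<theta> `` {oper M g (map (eval M w) ts)}"
      using oper_quotient_alg[OF \<theta>, of g "map (eval M w) ts"] App.prems by simp
    moreover have "map (eval (quotient_alg M \<theta>) (\<lambda>n. \<theta> `` {w n})) ts
        = map (\<lambda>x. \<theta> `` {x}) (map (eval M w) ts)"
      using App by auto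
    ultimately show ?case
      by (simp only: eval.simps)
  qed auto
  have "eval (quotient_alg M \<theta>) v s = eval (quotient_alg M \<theta>) v t"
    if st: "(s, t) \<in> E" and v: "range v \<subseteq> carrier (quotient_alg M \<theta>)" for s t v
  proof -
    have "\<forall>n. \<exists>x\<in>carrier M. v n = \<theta> `` {x}"
      using v by (auto simp: quotient_alg_def quotient_def)
    then obtain w where w: "\<And>n. w n \<in> carrier M" "\<And>n. v n = \<theta> `` {w n}"
      by metis
    then have "v = (\<lambda>n. \<theta> `` {w n})" "range w \<subseteq> carrier M"
      by auto
    then show ?thesis
      using ev E M st by (fastforce simp: wf_equations_def in_class_def)
  qed
  then show ?thesis
    using is_algebra_quotient_alg[OF alg \<theta>] by (auto simp: in_class_def)
qed

lemma rel_image_subset: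
  "f \<in> hom \<tau> A B \<Longrightarrow> \<theta> \<in> Con \<tau> A \<Longrightarrow> rel_image f \<theta> \<subseteq> carrier B \<times> carrier B"
  by (drule ConD(2)) (auto simp: rel_image_def hom_def)

lemma induced_class:
  assumes "is_algebra \<tau> B" "f \<in> hom \<tau> A B" "\<theta> \<in> Con \<tau> A" "a \<in> carrier A"
  shows "induced \<tau> B f \<theta> (\<theta> `` {a}) = Cg \<tau> B (rel_image f \<theta>) `` {f a}"
proof -
  let ?\<chi> = "Cg \<tau> B (rel_image f \<theta>)"
  have \<chi>: "?\<chi> \<in> Con \<tau> B"
    using Cg_Con rel_image_subset assms by metis
  have "(f a, f b) \<in> ?\<chi>" if "(a, b) \<in> \<theta>" for b
    using that Cg_upper[of "rel_image f \<theta>" \<tau> B] by (auto simp: rel_image_def)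
  then show ?thesis
    using ConD(3)[OF assms(3,4)] ConD(5)[OF \<chi>] by (auto simp: induced_def; blast)
qed

lemma induced_hom:
  assumes A: "is_algebra \<tau> A" and B: "is_algebra \<tau> B" and f: "f \<in> hom \<tau> A B" and \<theta>: "\<theta> \<in> Con \<tau> A"
  shows "induced \<tau> B f \<theta> \<in>
    hom \<tau> (quotient_alg A \<theta>) (quotient_alg B (Cg \<tau> B (rel_image f \<theta>)))"
proof -
  let ?\<chi> = "Cg \<tau> B (rel_image f \<theta>)"
  have \<chi>: "?\<chi> \<in> Con \<tau> B"
    using Cg_Con rel_image_subset B f \<theta> by metis
  note ind = induced_class[OF B f \<theta>]
  have "induced \<tau> B f \<theta> (oper (quotient_alg A \<theta>) g Xs)
      = oper (quotient_alg B ?\<chi>) g (map (induced \<tau> B f \<theta>) Xs)"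
    if g: "\<tau> g = Some (length Xs)" and "set Xs \<subseteq> carrier A // \<theta>" for g Xs
  proof -
    obtain xs where xs: "set xs \<subseteq> carrier A" "Xs = map (\<lambda>x. \<theta> `` {x}) xs"
      using \<open>set Xs \<subseteq> carrier A // \<theta>\<close> by (auto elim: quotient_reps)
    have g': "\<tau> g = Some (length xs)" "\<tau> g = Some (length (map f xs))"
      using g xs by auto
    have fxs: "set (map f xs) \<subseteq> carrier B"
      using f xs(1) by (auto simp: hom_def)
    have *: "map (induced \<tau> B f \<theta>) Xs = map (\<lambda>y. ?\<chi> `` {y}) (map f xs)"
      using ind xs by auto
    have "oper A g xs \<in> carrier A" "f (oper A g xs) = oper B g (map f xs)"
      using A f g'(1) xs(1) by (auto simp: is_algebra_def hom_def)
    then show ?thesis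
      unfolding * oper_quotient_alg[OF \<chi> g'(2) fxs]
      unfolding xs(2) oper_quotient_alg[OF \<theta> g'(1) xs(1)] by (simp add: ind)
  qed
  moreover have "induced \<tau> B f \<theta> ` (carrier A // \<theta>) \<subseteq> carrier B // ?\<chi>"
    using f ind by (auto simp: hom_def image_subset_iff elim!: quotientE intro!: quotientI)
  ultimately show ?thesis
    by (auto simp: hom_def quotient_alg_def)
qed

lemma pullback_Con:
  assumes A: "is_algebra \<tau> A" and f: "f \<in> hom \<tau> A B" and \<psi>: "\<psi> \<in> Con \<tau> B"
  shows "pullback A f \<psi> \<in> Con \<tau> A"
proof (rule ConI)
  show "(oper A g xs, oper A g ys) \<in> pullback A f \<psi>"
    if g: "\<tau> g = Some (length xs)" and xy: "list_all2 (\<lambda>x y. (x, y) \<in> pullback A f \<psi>) xs ys"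
    for g xs ys
  proof -
    have *: "set xs \<subseteq> carrier A" "set ys \<subseteq> carrier A"
      using list_all2_carrier[OF xy] by (auto simp: pullback_def)
    have "list_all2 (\<lambda>x y. (x, y) \<in> \<psi>) (map f xs) (map f ys)"
      using xy by (auto simp: list_all2_map1 list_all2_map2 pullback_def elim: list_all2_mono)
    then have "(oper B g (map f xs), oper B g (map f ys)) \<in> \<psi>"
      using ConD(6)[OF \<psi>] g by simp
    then show ?thesis
      using * A f g list_all2_lengthD[OF xy] by (simp add: pullback_def hom_def is_algebra_def)
  qed
next
  show "(x, x) \<in> pullback A f \<psi>" if "x \<in> carrier A" for x
    using that f ConD(3)[OF \<psi>, of "f x"] by (auto simp: pullback_def hom_def)
  show "(y, x) \<in> pullback A f \<psi>" if "(x, y) \<in> pullback A f \<psi>" for x y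
    using that ConD(4)[OF \<psi>] by (simp add: pullback_def)
  show "(x, z) \<in> pullback A f \<psi>"
    if "(x, y) \<in> pullback A f \<psi>" "(y, z) \<in> pullback A f \<psi>" for x y z
    using that ConD(5)[OF \<psi>, of "f x" "f y" "f z"] by (simp add: pullback_def)
qed (auto simp: pullback_def)

lemma Cg_Un_trancl:
  assumes \<alpha>: "\<alpha> \<in> Con \<tau> M" and \<beta>: "\<beta> \<in> Con \<tau> M"
  shows "Cg \<tau> M (\<alpha> \<union> \<beta>) \<subseteq> (\<alpha> \<union> \<beta>)\<^sup>+"
proof (rule Cg_least[OF ConI])
  let ?R = "(\<alpha> \<union> \<beta>)\<^sup>+"
  show sub: "?R \<subseteq> carrier M \<times> carrier M"
    using ConD(2)[OF \<alpha>] ConD(2)[OF \<beta>] by (simp add: trancl_subset_Sigma)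
  show "x \<in> carrier M \<Longrightarrow> (x, x) \<in> ?R" for x
    using ConD(3)[OF \<alpha>] by blast
  show "(x, y) \<in> ?R \<Longrightarrow> (y, x) \<in> ?R" for x y
    using ConD(4)[OF \<alpha>] ConD(4)[OF \<beta>] sym_trancl[of "\<alpha> \<union> \<beta>"] unfolding sym_def by blast
  show trans: "(x, y) \<in> ?R \<Longrightarrow> (y, z) \<in> ?R \<Longrightarrow> (x, z) \<in> ?R" for x y z
    by simp
  have one: "(oper M g (ps @ x # qs), oper M g (ps @ y # qs)) \<in> ?R"
    if g: "\<tau> g = Some (length ps + Suc (length qs))" and "set ps \<subseteq> carrier M" "set qs \<subseteq> carrier M"
      and "(x, y) \<in> ?R" for g ps x y qs
    using that(4)
  proof (induction rule: trancl_induct)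
    have step: "(oper M g (ps @ x # qs), oper M g (ps @ y # qs)) \<in> \<theta>"
      if "\<theta> \<in> Con \<tau> M" "(x, y) \<in> \<theta>" for x y \<theta>
    proof -
      have "list_all2 (\<lambda>x y. (x, y) \<in> \<theta>) (ps @ x # qs) (ps @ y # qs)"
        using that(2) \<open>set ps \<subseteq> carrier M\<close> \<open>set qs \<subseteq> carrier M\<close> ConD(3)[OF that(1)]
        by (intro list_all2_appendI) (simp_all add: list_all2_same subset_iff)
      then show ?thesis
        using ConD(6)[OF that(1)] g by simp
    qed
    { case (base y)
      then show ?case
        using step \<alpha> \<beta> by blast }
    { case (step y z)
      then show ?case
        using \<open>\<And>\<theta> x y. \<theta> \<in> Con \<tau> M \<Longrightarrow> (x, y) \<in> \<theta> \<Longrightarrow>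
          (oper M g (ps @ x # qs), oper M g (ps @ y # qs)) \<in> \<theta>\<close> \<alpha> \<beta>
        by (metis Un_iff trancl.trancl_into_trancl) }
  qed
  have many: "(oper M g (ps @ xs), oper M g (ps @ ys)) \<in> ?R"
    if "list_all2 (\<lambda>x y. (x, y) \<in> ?R) xs ys" "\<tau> g = Some (length ps + length xs)"
      "set ps \<subseteq> carrier M" "xs \<noteq> []" for g ps xs ys
    using that
  proof (induction arbitrary: ps rule: list_all2_induct)
    case (Cons x xs y ys)
    have xy: "x \<in> carrier M" "y \<in> carrier M"
      using Cons.hyps(1) sub by auto
    have "set xs \<subseteq> carrier M"
      using list_all2_carrier[OF Cons.hyps(2) sub] by simp
    then have 1: "(oper M g (ps @ x # xs), oper M g (ps @ y # xs)) \<in> ?R"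
      using one Cons xy by simp
    show ?case
    proof (cases "xs = []")
      case True
      with 1 Cons.hyps(2) show ?thesis by simp
    next
      case False
      with Cons.IH[of "ps @ [y]"] Cons.prems xy
      have "(oper M g (ps @ y # xs), oper M g (ps @ y # ys)) \<in> ?R" by simp
      with 1 show ?thesis by (rule trans)
    qed
  qed simp
  show "(oper M g xs, oper M g ys) \<in> ?R"
    if "\<tau> g = Some (length xs)" "list_all2 (\<lambda>x y. (x, y) \<in> ?R) xs ys" for g xs ys
  proof (cases "xs = []")
    case True
    with that show ?thesis
      using ConD(6)[OF \<alpha>, of g "[]" "[]"] by auto
  next
    case False
    with many[OF that(2), of g "[]"] that(1) show ?thesis by simp
  qed
qed auto

lemma trancl_finite:
  assumes "(x, y) \<in> R\<^sup>+"
  shows "\<exists>zs. (x, y) \<in> (Restr R (set zs))\<^sup>+ \<and> set zs \<subseteq> Field R"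
  using assms
proof (induction rule: trancl_induct)
  case (base y)
  then show ?case
    by (intro exI[of _ "[x, y]"]) (auto simp: Field_def)
next
  case (step y z)
  then obtain zs where zs: "(x, y) \<in> (Restr R (set zs))\<^sup>+" "set zs \<subseteq> Field R"
    by blast
  have "y \<in> set zs"
    using zs(1) by (meson IntD2 mem_Sigma_iff tranclE)
  then have "(y, z) \<in> Restr R (set (z # zs))"
    using step by auto
  moreover have "(x, y) \<in> (Restr R (set (z # zs)))\<^sup>+"
    by (rule trancl_mono[OF zs(1)]) auto
  ultimately have "(x, z) \<in> (Restr R (set (z # zs)))\<^sup>+"
    by (rule trancl_into_trancl[rotated])
  moreover have "set (z # zs) \<subseteq> Field R"
    using zs(2) step(2) by (auto simp: Field_def)
  ultimately show ?case by blast
qed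

text \<open>A failure of the modular law in some \<open>M\<close> is witnessed by finitely many elements of \<open>M\<close>; the
  subalgebra they generate has an isomorphic copy whose elements are terms.\<close>

lemma congruence_modular_in_class:
  fixes M :: "('s, 'a) algebra"
  assumes E: "wf_equations \<tau> E" and cm: "congruence_modular \<tau> E" and M: "in_class \<tau> E M"
  shows "Con_modular \<tau> M"
  unfolding Con_modular_def
proof (intro ballI impI subset_antisym)
  fix \<alpha> \<beta> \<gamma>
  assume \<alpha>: "\<alpha> \<in> Con \<tau> M" and \<beta>: "\<beta> \<in> Con \<tau> M" and \<gamma>: "\<gamma> \<in> Con \<tau> M" and "\<alpha> \<subseteq> \<gamma>"
  have alg: "is_algebra \<tau> M"
    using M by (simp add: in_class_def)
  have sub: "\<alpha> \<union> \<beta> \<subseteq> carrier M \<times> carrier M" "\<alpha> \<union> (\<beta> \<inter> \<gamma>) \<subseteq> carrier M \<times> carrier M"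
    using ConD(2)[OF \<alpha>] ConD(2)[OF \<beta>] by blast+
  show "Cg \<tau> M (\<alpha> \<union> (\<beta> \<inter> \<gamma>)) \<subseteq> Cg \<tau> M (\<alpha> \<union> \<beta>) \<inter> \<gamma>"
    using Cg_least[OF \<gamma>, of "\<alpha> \<union> (\<beta> \<inter> \<gamma>)"] Cg_least[OF Cg_Con[OF alg sub(1)], of "\<alpha> \<union> (\<beta> \<inter> \<gamma>)"]
      Cg_upper[of "\<alpha> \<union> \<beta>" \<tau> M] \<open>\<alpha> \<subseteq> \<gamma>\<close> by blast
  show "Cg \<tau> M (\<alpha> \<union> \<beta>) \<inter> \<gamma> \<subseteq> Cg \<tau> M (\<alpha> \<union> (\<beta> \<inter> \<gamma>))"
  proof (rule subrelI)
    fix x y assume xy: "(x, y) \<in> Cg \<tau> M (\<alpha> \<union> \<beta>) \<inter> \<gamma>"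
    then have xy\<gamma>: "(x, y) \<in> \<gamma>" ..
    have "(x, y) \<in> (\<alpha> \<union> \<beta>)\<^sup>+"
      using xy Cg_Un_trancl[OF \<alpha> \<beta>] by auto
    from trancl_finite[OF this] obtain zs where zs: "(x, y) \<in> (Restr (\<alpha> \<union> \<beta>) (set zs))\<^sup>+" "set zs \<subseteq> Field (\<alpha> \<union> \<beta>)"
      by blast
    have zs_carrier: "set zs \<subseteq> carrier M"
      using zs(2) sub(1) by (auto simp: Field_def)
    have x: "x \<in> carrier M"
      using xy\<gamma> ConD(2)[OF \<gamma>] by blast
    define v where "v n = (if n < length zs then zs ! n else x)" for n
    have v: "range v \<subseteq> carrier M" "set zs \<subseteq> range v"
    proof -
      show "range v \<subseteq> carrier M"
        using zs_carrier x by (auto simp: v_def)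
      show "set zs \<subseteq> range v"
      proof
        fix z assume "z \<in> set zs"
        then obtain n where "n < length zs" "z = zs ! n"
          by (auto simp: in_set_conv_nth)
        then have "z = v n" by (simp add: v_def)
        then show "z \<in> range v" by simp
      qed
    qed
    define h :: "('s, nat) trm \<Rightarrow> 'a" where "h = eval M v"
    define r where "r = inv_into {t. wf_trm \<tau> t} h"
    define N where "N = h ` {t. wf_trm \<tau> t}"
    have r: "h (r z) = z" if "z \<in> N" for z
      using that unfolding r_def N_def by (rule f_inv_into_f)
    have N_carrier: "N \<subseteq> carrier M"
      using eval_carrier[OF alg v(1)] by (auto simp: N_def h_def)
    have N_oper: "oper M g ys \<in> N" if "\<tau> g = Some (length ys)" "set ys \<subseteq> N" for g ys
    proof -
      have "map h (map r ys) = ys"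
        using that(2) r by (simp add: map_idI subset_iff)
      moreover have "wf_trm \<tau> (App g (map r ys))"
        using that by (auto simp: r_def N_def intro: inv_into_into[of _ h "{t. wf_trm \<tau> t}", simplified])
      moreover have "h (App g (map r ys)) = oper M g (map h (map r ys))"
        by (simp add: h_def)
      ultimately show ?thesis
        unfolding N_def by (metis (mono_tags, lifting) image_eqI mem_Collect_eq)
    qed
    have vN: "range v \<subseteq> N"
    proof
      fix z assume "z \<in> range v"
      then obtain n where "z = h (Var n)" by (auto simp: h_def)
      then show "z \<in> N" by (auto simp: N_def)
    qed
    define K where "K = \<lparr>carrier = r ` N, oper = (\<lambda>g ts. r (oper M g (map h ts)))\<rparr>"
    have K [simp]: "carrier K = r ` N" "oper K g ts = r (oper M g (map h ts))" for g ts
      by (simp_all add: K_def)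
    have hK: "h t \<in> N" if "t \<in> r ` N" for t
      using that r by auto
    have hinj: "s = t" if "h s = h t" "s \<in> r ` N" "t \<in> r ` N" for s t
      using that r by auto
    have hset: "set (map h ts) \<subseteq> N" if "set ts \<subseteq> r ` N" for ts
      using that hK by auto
    have algK: "is_algebra \<tau> K"
      unfolding is_algebra_def
    proof (intro conjI allI impI)
      show "carrier K \<noteq> {}"
        using vN by auto
      show "oper K g ts \<in> carrier K" if "\<tau> g = Some (length ts)" "set ts \<subseteq> carrier K" for g ts
        using N_oper[of g "map h ts"] hset[of ts] that by simp
    qed
    have homK: "h \<in> hom \<tau> K M"
      unfolding hom_def
    proof (intro CollectI conjI allI impI)
      show "h ` carrier K \<subseteq> carrier M"
        using hK N_carrier by auto
      show "h (oper K g ts) = oper M g (map h ts)"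
        if "\<tau> g = Some (length ts)" "set ts \<subseteq> carrier K" for g ts
        using N_oper[of g "map h ts"] hset[of ts] that r by simp
    qed
    have evK: "h (eval K w t) = eval M (\<lambda>n. h (w n)) t" if "range w \<subseteq> r ` N" "wf_trm \<tau> t"
      for w and t :: "('s, nat) trm"
      using that(2)
    proof (induction t)
      case (App g ts)
      have "set (map (eval K w) ts) \<subseteq> carrier K"
        using eval_carrier[OF algK, of w] that(1) App.prems by auto
      then have "h (oper K g (map (eval K w) ts)) = oper M g (map h (map (eval K w) ts))"
        using homK App.prems unfolding hom_def by (simp del: K map_map set_map)
      moreover have "map h (map (eval K w) ts) = map (eval M (\<lambda>n. h (w n))) ts"
        using App by auto
      ultimately show ?case
        by (simp only: eval.simps)
    qed simp
    have "in_class \<tau> E K"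
      unfolding in_class_def
    proof (intro conjI ballI algK, clarify)
      fix s t and w :: "nat \<Rightarrow> ('s, nat) trm"
      assume st: "(s, t) \<in> E" and w: "range w \<subseteq> carrier K"
      have wf: "wf_trm \<tau> s" "wf_trm \<tau> t"
        using E st by (auto simp: wf_equations_def)
      have "range (\<lambda>n. h (w n)) \<subseteq> carrier M"
        using w hK N_carrier by fastforce
      then have "eval M (\<lambda>n. h (w n)) s = eval M (\<lambda>n. h (w n)) t"
        using M st by (auto simp: in_class_def)
      then have "h (eval K w s) = h (eval K w t)"
        using evK w wf by simp
      then show "eval K w s = eval K w t"
        using hinj eval_carrier[OF algK w] wf by simp
    qed
    then have mod: "Con_modular \<tau> K"
      using cm by (simp add: congruence_modular_def)
    let ?p = "pullback K h"
    have p: "?p \<theta> \<in> Con \<tau> K" if "\<theta> \<in> Con \<tau> M" for \<theta>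
      using pullback_Con[OF algK homK that] .
    have xyN: "x \<in> set zs" "y \<in> set zs"
      using zs(1) by (meson IntD2 mem_Sigma_iff tranclD tranclD2)+
    have zsN: "set zs \<subseteq> N"
      using v(2) vN by blast
    have CK: "Cg \<tau> K (?p \<alpha> \<union> ?p \<beta>) \<in> Con \<tau> K"
      using ConD(2)[OF p[OF \<alpha>]] ConD(2)[OF p[OF \<beta>]] by (intro Cg_Con algK) auto
    have "(r x, r z) \<in> Cg \<tau> K (?p \<alpha> \<union> ?p \<beta>)" if "(x, z) \<in> (Restr (\<alpha> \<union> \<beta>) (set zs))\<^sup>+" for z
    proof -
      have step: "(r u, r w) \<in> Cg \<tau> K (?p \<alpha> \<union> ?p \<beta>)" if "(u, w) \<in> Restr (\<alpha> \<union> \<beta>) (set zs)" for u w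
      proof -
        have "(r u, r w) \<in> ?p \<alpha> \<union> ?p \<beta>"
          using that zsN r by (auto simp: pullback_def subset_iff)
        then show ?thesis using Cg_upper by blast
      qed
      show ?thesis
        using that
      proof (induction rule: trancl_induct)
        case (base z)
        then show ?case by (rule step)
      next
        case (step y z)
        then show ?case
          using \<open>\<And>w u. (u, w) \<in> Restr (\<alpha> \<union> \<beta>) (set zs) \<Longrightarrow> (r u, r w) \<in> Cg \<tau> K (?p \<alpha> \<union> ?p \<beta>)\<close>
            ConD(5)[OF CK] by blast
      qed
    qed
    then have "(r x, r y) \<in> Cg \<tau> K (?p \<alpha> \<union> ?p \<beta>)"
      using zs(1) .
    moreover have "(r x, r y) \<in> ?p \<gamma>"
      using xyN zsN xy\<gamma> r by (auto simp: pullback_def subset_iff)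
    moreover have "?p \<alpha> \<subseteq> ?p \<gamma>"
      using \<open>\<alpha> \<subseteq> \<gamma>\<close> by (auto simp: pullback_def)
    ultimately have "(r x, r y) \<in> Cg \<tau> K (?p \<alpha> \<union> (?p \<beta> \<inter> ?p \<gamma>))"
      using mod p[OF \<alpha>] p[OF \<beta>] p[OF \<gamma>] unfolding Con_modular_def by blast
    moreover have "?p \<alpha> \<union> (?p \<beta> \<inter> ?p \<gamma>) \<subseteq> ?p (Cg \<tau> M (\<alpha> \<union> (\<beta> \<inter> \<gamma>)))"
      using Cg_upper[of "\<alpha> \<union> (\<beta> \<inter> \<gamma>)" \<tau> M] by (auto simp: pullback_def)
    ultimately have "(r x, r y) \<in> ?p (Cg \<tau> M (\<alpha> \<union> (\<beta> \<inter> \<gamma>)))"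
      using Cg_least[OF p[OF Cg_Con[OF alg sub(2)]]] by blast
    then show "(x, y) \<in> Cg \<tau> M (\<alpha> \<union> (\<beta> \<inter> \<gamma>))"
      using xyN zsN r by (auto simp: pullback_def subset_iff)
  qed
qed

end

theory Submission
  imports Defs
begin

text \<open>Along a surjection \<open>\<pi> : M \<rightarrow> N\<close>, pulling back matches the congruences of \<open>N\<close> with the
  congruences of \<open>M\<close> above the kernel, and everything reduces to showing that it matches prime
  congruences with prime congruences. That \<open>\<psi>\<close> is prime if \<open>\<pi>\<^sup>*(\<psi>)\<close> is holds in general, as
  centrality pulls back. For the converse one must know that \<open>[\<alpha>, \<beta>] \<subseteq> \<phi>\<close> implies that
  \<open>\<alpha> \<or> \<phi>\<close> centralizes \<open>\<beta> \<or> \<phi>\<close> modulo \<open>\<phi>\<close>. This is where modularity enters: by means of Day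
  terms, centrality of \<open>\<alpha>\<close> and \<open>\<beta>\<close> modulo \<open>\<delta>\<close> says that \<open>\<delta>\<close> contains certain pairs, a condition
  that is upward closed in \<open>\<delta>\<close> and yields symmetry in \<open>\<alpha>\<close> and \<open>\<beta>\<close>.\<close>

section \<open>Terms\<close>

primrec subst :: "('v \<Rightarrow> ('s, 'w) trm) \<Rightarrow> ('s, 'v) trm \<Rightarrow> ('s, 'w) trm" where
  "subst \<sigma> (Var x) = \<sigma> x"
| "subst \<sigma> (App g ts) = App g (map (subst \<sigma>) ts)"

lemma eval_subst: "eval M v (subst \<sigma> t) = eval M (\<lambda>x. eval M v (\<sigma> x)) t"
proof (induction t)
  case (App g ts)
  then show ?case by (simp add: comp_def cong: map_cong)
qed simp

lemma wf_subst: "wf_trm \<tau> t \<Longrightarrow> (\<And>x. wf_trm \<tau> (\<sigma> x)) \<Longrightarrow> wf_trm \<tau> (subst \<sigma> t)"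
  by (induction t) auto

lemma eval_vars_cong: "(\<And>x. x \<in> set2_trm t \<Longrightarrow> v x = w x) \<Longrightarrow> eval M v t = eval M w t"
proof (induction t)
  case (App g ts)
  then have "map (eval M v) ts = map (eval M w) ts"
    by auto
  then show ?case by (simp only: eval.simps)
qed simp

lemma finite_vars: "finite (set2_trm t)"
  by (induction t) auto

lemma eval_Con:
  assumes \<theta>: "\<theta> \<in> Con \<tau> M" and "wf_trm \<tau> t" and vw: "\<And>x. (v x, w x) \<in> \<theta>"
  shows "(eval M v t, eval M w t) \<in> \<theta>"
  using assms(2)
proof (induction t)
  case (App g ts)
  then have "list_all2 (\<lambda>x y. (x, y) \<in> \<theta>) (map (eval M v) ts) (map (eval M w) ts)"
    by (auto simp: list_all2_map1 list_all2_map2 list_all2_same)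
  then show ?case
    using ConD(6)[OF \<theta>] App.prems by simp
qed (use vw in simp)

lemma hom_eval:
  assumes "is_algebra \<tau> M" and f: "f \<in> hom \<tau> M N" and v: "range v \<subseteq> carrier M" and "wf_trm \<tau> t"
  shows "f (eval M v t) = eval N (\<lambda>x. f (v x)) t"
  using assms(4)
proof (induction t)
  case (App g ts)
  have "set (map (eval M v) ts) \<subseteq> carrier M"
    using eval_carrier[OF assms(1) v] App.prems by auto
  then have "f (oper M g (map (eval M v) ts)) = oper N g (map f (map (eval M v) ts))"
    using f App.prems by (simp add: hom_def)
  moreover have "map f (map (eval M v) ts) = map (eval N (\<lambda>x. f (v x))) ts"
    using App by auto
  ultimately show ?case
    by (simp only: eval.simps)
qed simp


section \<open>Day terms\<close>

text \<open>The subalgebra of a power of \<open>M\<close> formed by the term operations in the variables \<open>'v\<close>: the free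
  algebra over \<open>'v\<close> in the equational class generated by \<open>M\<close>.\<close>

definition term_op :: "('s, 'a) algebra \<Rightarrow> ('s, 'v) trm \<Rightarrow> ('v \<Rightarrow> 'a) \<Rightarrow> 'a" where
  "term_op M t v = (if range v \<subseteq> carrier M then eval M v t else undefined)"

definition clone_alg ::
  "'s signature \<Rightarrow> ('s, 'a) algebra \<Rightarrow> ('s, ('v \<Rightarrow> 'a) \<Rightarrow> 'a) algebra" where
  "clone_alg \<tau> M = \<lparr>carrier = term_op M ` {t. wf_trm \<tau> t},
     oper = (\<lambda>g ps v. if range v \<subseteq> carrier M then oper M g (map (\<lambda>p. p v) ps) else undefined)\<rparr>"

lemma oper_clone_alg:
  "oper (clone_alg \<tau> M) g (map (term_op M) ts) = term_op M (App g ts)"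
proof
  fix v
  show "oper (clone_alg \<tau> M) g (map (term_op M) ts) v = term_op M (App g ts) v"
    by (simp add: clone_alg_def term_op_def comp_def)
qed

lemma is_algebra_clone_alg:
  fixes M :: "('s, 'a) algebra"
  shows "is_algebra \<tau> (clone_alg \<tau> M :: ('s, ('v \<Rightarrow> 'a) \<Rightarrow> 'a) algebra)"
  unfolding is_algebra_def
proof (intro conjI allI impI)
  have "term_op M (Var undefined) \<in> carrier (clone_alg \<tau> M :: ('s, ('v \<Rightarrow> 'a) \<Rightarrow> 'a) algebra)"
    by (auto simp: clone_alg_def)
  then show "carrier (clone_alg \<tau> M :: ('s, ('v \<Rightarrow> 'a) \<Rightarrow> 'a) algebra) \<noteq> {}"
    by blast
  fix g and ps :: "(('v \<Rightarrow> 'a) \<Rightarrow> 'a) list"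
  assume g: "\<tau> g = Some (length ps)" and ps: "set ps \<subseteq> carrier (clone_alg \<tau> M)"
  have "ps \<in> lists (term_op M ` {t. wf_trm \<tau> t})"
    using ps by (auto simp: clone_alg_def)
  then obtain ts where ts: "\<forall>t\<in>set ts. wf_trm \<tau> t" "ps = map (term_op M) ts"
    by (auto simp: lists_image)
  then have "wf_trm \<tau> (App g ts)"
    using g by simp
  then show "oper (clone_alg \<tau> M) g ps \<in> carrier (clone_alg \<tau> M)"
    unfolding ts(2) oper_clone_alg by (simp add: clone_alg_def)
qed

lemma eval_clone_alg:
  assumes "range w \<subseteq> carrier (clone_alg \<tau> M)" "wf_trm \<tau> t"
  shows "eval (clone_alg \<tau> M) w t =
    (\<lambda>v. if range v \<subseteq> carrier M then eval M (\<lambda>n. w n v) t else undefined)"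
  using assms(2)
proof (induction t)
  case (Var x)
  \<comment> \<open>Term operations are \<open>undefined\<close> off the valuations into
    \<open>carrier M\<close>, which is what the right-hand side requires there.\<close>
  have "w x \<in> carrier (clone_alg \<tau> M)"
    using assms(1) by blast
  then obtain s where "w x = term_op M s"
    by (auto simp: clone_alg_def)
  then show ?case
    by (simp add: term_op_def fun_eq_iff)
next
  case (App g ts)
  have args: "map (\<lambda>p. p v) (map (eval (clone_alg \<tau> M) w) ts) = map (eval M (\<lambda>n. w n v)) ts"
    if "range v \<subseteq> carrier M" for v
    using App that by auto
  have oper: "oper (clone_alg \<tau> M) g ps v =
    (if range v \<subseteq> carrier M then oper M g (map (\<lambda>p. p v) ps) else undefined)" for ps v
    by (simp add: clone_alg_def)
  show ?case
    by (rule ext) (simp only: eval.simps oper args cong: if_cong)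
qed

lemma clone_alg_apply_carrier:
  assumes "is_algebra \<tau> M" "p \<in> carrier (clone_alg \<tau> M)" "range v \<subseteq> carrier M"
  shows "p v \<in> carrier M"
  using assms eval_carrier[OF assms(1,3)] by (auto simp: clone_alg_def term_op_def)

text \<open>Operations act coordinatewise, so an equation of \<open>M\<close> holds at each
  valuation into \<open>carrier M\<close>. At all other valuations both sides take the same default
  value, so they are equal as functions.\<close>

lemma in_class_clone_alg:
  fixes M :: "('s, 'a) algebra"
  assumes E: "wf_equations \<tau> E" and M: "in_class \<tau> E M"
  shows "in_class \<tau> E (clone_alg \<tau> M :: ('s, ('v \<Rightarrow> 'a) \<Rightarrow> 'a) algebra)"
  unfolding in_class_def
proof (intro conjI ballI is_algebra_clone_alg, clarify)
  fix s t and w :: "nat \<Rightarrow> ('v \<Rightarrow> 'a) \<Rightarrow> 'a"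
  assume st: "(s, t) \<in> E" and w: "range w \<subseteq> carrier (clone_alg \<tau> M)"
  have alg: "is_algebra \<tau> M"
    using M by (simp add: in_class_def)
  have "eval M (\<lambda>n. w n v) s = eval M (\<lambda>n. w n v) t" if "range v \<subseteq> carrier M" for v
  proof -
    have "range (\<lambda>n. w n v) \<subseteq> carrier M"
      using clone_alg_apply_carrier[OF alg _ that] w by blast
    then show ?thesis
      using M st by (auto simp: in_class_def)
  qed
  then show "eval (clone_alg \<tau> M) w s = eval (clone_alg \<tau> M) w t"
    using eval_clone_alg[OF w] E st by (auto simp: wf_equations_def fun_eq_iff)
qed

text \<open>When \<open>V\<close> consists of all valuations into \<open>carrier M\<close> that
  identify certain variables, this is the kernel of the homomorphism of the free algebra that
  identifies them.\<close>

definition agree :: "'s signature \<Rightarrow> ('s, 'a) algebra \<Rightarrow> ('v \<Rightarrow> 'a) set \<Rightarrow> (('v \<Rightarrow> 'a) \<Rightarrow> 'a) rel" where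
  "agree \<tau> M V = {(p, q). p \<in> carrier (clone_alg \<tau> M) \<and> q \<in> carrier (clone_alg \<tau> M) \<and>
     (\<forall>v\<in>V. p v = q v)}"

lemma agree_Con:
  fixes M :: "('s, 'a) algebra" and V :: "('v \<Rightarrow> 'a) set"
  shows "agree \<tau> M V \<in> Con \<tau> (clone_alg \<tau> M)"
proof (rule ConI)
  show sub: "agree \<tau> M V \<subseteq> carrier (clone_alg \<tau> M) \<times> carrier (clone_alg \<tau> M)"
    by (auto simp: agree_def)
  fix g and ps qs :: "(('v \<Rightarrow> 'a) \<Rightarrow> 'a) list"
  assume g: "\<tau> g = Some (length ps)" and pq: "list_all2 (\<lambda>p q. (p, q) \<in> agree \<tau> M V) ps qs"
  have "oper (clone_alg \<tau> M) g ps \<in> carrier (clone_alg \<tau> M)"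
    "oper (clone_alg \<tau> M) g qs \<in> carrier (clone_alg \<tau> M)"
    using is_algebra_clone_alg g list_all2_carrier[OF pq sub] list_all2_lengthD[OF pq]
    unfolding is_algebra_def by metis+
  moreover have "map (\<lambda>p. p v) ps = map (\<lambda>q. q v) qs" if "v \<in> V" for v
    using pq that by (auto simp: agree_def list_all2_conv_all_nth intro!: nth_equalityI)
  ultimately show "(oper (clone_alg \<tau> M) g ps, oper (clone_alg \<tau> M) g qs) \<in> agree \<tau> M V"
    by (auto simp: agree_def) (auto simp: clone_alg_def)
qed (auto simp: agree_def)

text \<open>The type \<open>bool + bool\<close> serves as the set of Day's four variables
  \<open>x, y, z, u\<close>, in the order \<open>Inl True\<close>, \<open>Inl False\<close>,
  \<open>Inr True\<close>, \<open>Inr False\<close>.\<close>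

abbreviation quad :: "'a \<Rightarrow> 'a \<Rightarrow> 'a \<Rightarrow> 'a \<Rightarrow> bool + bool \<Rightarrow> 'a" where
  "quad a b c d \<equiv> case_sum (case_bool a b) (case_bool c d)"

lemma range_quad: "range (quad a b c d) = {a, b, c, d}"
  by (auto simp: UNIV_sum UNIV_bool image_Un)

text \<open>This is the one identity of Day that every term of the chain satisfies by itself. The
  identities linking neighbouring terms are carried by the steps of the chain in
  \<open>day_chain\<close>.\<close>

definition day_term :: "'s signature \<Rightarrow> ('s, 'a) algebra \<Rightarrow> ('s, bool + bool) trm \<Rightarrow> bool" where
  "day_term \<tau> M m \<longleftrightarrow> wf_trm \<tau> m \<and>
     (\<forall>x\<in>carrier M. \<forall>y\<in>carrier M. eval M (quad x y y x) m = x)"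

text \<open>Day's argument: in the free algebra over \<open>x, y, z, u\<close>, the modular law turns the chain
  \<open>x, y, z, u\<close> into one that does not leave the kernel of the substitution \<open>u := x, z := y\<close>;
  its members are the Day terms.\<close>

lemma day_chain:
  fixes M :: "('s, 'a) algebra"
  assumes E: "wf_equations \<tau> E" and cm: "congruence_modular \<tau> E" and M: "in_class \<tau> E M"
  defines "C \<equiv> carrier M"
  defines "\<alpha> \<equiv> agree \<tau> M {quad x y y x | x y. x \<in> C \<and> y \<in> C}"
    and "\<beta> \<equiv> agree \<tau> M {quad x x z z | x z. x \<in> C \<and> z \<in> C}"
    and "\<gamma> \<equiv> agree \<tau> M {quad x y y u | x y u. x \<in> C \<and> y \<in> C \<and> u \<in> C}"
  shows "(term_op M (Var (Inl True)), term_op M (Var (Inr False))) \<in> (\<gamma> \<union> (\<beta> \<inter> \<alpha>))\<^sup>+"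
proof -
  let ?F = "clone_alg \<tau> M :: ('s, (bool + bool \<Rightarrow> 'a) \<Rightarrow> 'a) algebra"
  let ?X = "\<lambda>i. term_op M (Var i) :: (bool + bool \<Rightarrow> 'a) \<Rightarrow> 'a"
  have con: "\<alpha> \<in> Con \<tau> ?F" "\<beta> \<in> Con \<tau> ?F" "\<gamma> \<in> Con \<tau> ?F" "\<beta> \<inter> \<alpha> \<in> Con \<tau> ?F"
    using Con_Inter[of "{\<beta>, \<alpha>}" \<tau> ?F] unfolding \<alpha>_def \<beta>_def \<gamma>_def by (auto simp: agree_Con)
  \<comment> \<open>The valuations defining \<alpha> are those defining \<gamma> with
    \<open>u = x\<close>, and fewer valuations give a larger congruence.\<close>
  have "\<gamma> \<subseteq> \<alpha>"
    unfolding \<alpha>_def \<gamma>_def agree_def by blast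
  moreover have "Con_modular \<tau> ?F"
    using congruence_modular_in_class[OF E cm in_class_clone_alg[OF E M]] .
  ultimately have mod: "Cg \<tau> ?F (\<gamma> \<union> (\<beta> \<inter> \<alpha>)) = Cg \<tau> ?F (\<gamma> \<union> \<beta>) \<inter> \<alpha>"
    using con unfolding Con_modular_def by blast
  have X: "?X i \<in> carrier ?F" for i
    by (auto simp: clone_alg_def)
  \<comment> \<open>The chain \<open>x, y, z, u\<close>: \<beta> identifies \<open>x\<close> with
    \<open>y\<close> and \<open>z\<close> with \<open>u\<close>, while \<gamma> identifies
    \<open>y\<close> with \<open>z\<close>. Its endpoints are identified by \<alpha>.\<close>
  have "(?X (Inl True), ?X (Inl False)) \<in> \<beta>" "(?X (Inr True), ?X (Inr False)) \<in> \<beta>"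
    "(?X (Inl False), ?X (Inr True)) \<in> \<gamma>" "(?X (Inl True), ?X (Inr False)) \<in> \<alpha>"
    using X unfolding \<alpha>_def \<beta>_def \<gamma>_def agree_def by (auto simp: term_op_def)
  moreover have "Cg \<tau> ?F (\<gamma> \<union> \<beta>) \<in> Con \<tau> ?F"
    using ConD(2)[OF con(2)] ConD(2)[OF con(3)] by (intro Cg_Con is_algebra_clone_alg) auto
  ultimately have "(?X (Inl True), ?X (Inr False)) \<in> Cg \<tau> ?F (\<gamma> \<union> \<beta>) \<inter> \<alpha>"
    using Cg_upper[of "\<gamma> \<union> \<beta>" \<tau> ?F] ConD(5)[of "Cg \<tau> ?F (\<gamma> \<union> \<beta>)"] by blast
  then show ?thesis
    using mod Cg_Un_trancl[OF con(3,4)] by blast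
qed

text \<open>Along the Day chain the value at \<open>quad a a c c\<close> never leaves the
  \<delta>-class of \<open>a\<close>. A \<beta>-link keeps this value. A \<gamma>-link keeps the
  value at \<open>quad a b b c\<close>, and \<open>day\<close> together with
  \<open>(b, d) \<in> \<delta>\<close> relates the two values. The chain ends at the fourth
  variable, whose value is \<open>c\<close>.\<close>

lemma day_terms_collapse:
  assumes E: "wf_equations \<tau> E" and cm: "congruence_modular \<tau> E" and M: "in_class \<tau> E M"
    and \<delta>: "\<delta> \<in> Con \<tau> M" and ac: "a \<in> carrier M" "c \<in> carrier M" and bd: "(b, d) \<in> \<delta>"
    and day: "\<And>m. day_term \<tau> M m \<Longrightarrow> (eval M (quad a a c c) m, eval M (quad a b d c) m) \<in> \<delta>"
  shows "(a, c) \<in> \<delta>"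
proof -
  let ?C = "carrier M"
  let ?F = "clone_alg \<tau> M"
  have b: "b \<in> ?C" "d \<in> ?C"
    using ConD(2)[OF \<delta>] bd by blast+
  \<comment> \<open>Day's identity belongs to the invariant because the hypothesis
    \<open>day\<close> applies only to Day terms.\<close>
  define inv where "inv p \<longleftrightarrow> p \<in> carrier ?F \<and>
    (\<forall>x\<in>?C. \<forall>y\<in>?C. p (quad x y y x) = x) \<and> (a, p (quad a a c c)) \<in> \<delta>" for p
  have inv_mid: "(p (quad a a c c), p (quad a b b c)) \<in> \<delta>"
    if p: "p \<in> carrier ?F" "\<forall>x\<in>?C. \<forall>y\<in>?C. p (quad x y y x) = x" for p
  proof -
    obtain m where m: "wf_trm \<tau> m" "p = term_op M m"
      using p by (auto simp: clone_alg_def)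
    then have p_eval: "p (quad x y z u) = eval M (quad x y z u) m"
      if "x \<in> ?C" "y \<in> ?C" "z \<in> ?C" "u \<in> ?C" for x y z u
      using that by (simp add: term_op_def range_quad)
    have "day_term \<tau> M m"
      using m(1) p(2) p_eval by (auto simp: day_term_def)
    then have "(eval M (quad a a c c) m, eval M (quad a b d c) m) \<in> \<delta>"
      by (rule day)
    moreover have "(eval M (quad a b d c) m, eval M (quad a b b c) m) \<in> \<delta>"
      using ConD(3)[OF \<delta>] ConD(4)[OF \<delta> bd] ac b
      by (intro eval_Con[OF \<delta> m(1)]) (auto split: sum.splits bool.splits)
    ultimately show ?thesis
      using ConD(5)[OF \<delta>] p_eval ac b by simp
  qed
  let ?\<alpha> = "agree \<tau> M {quad x y y x | x y. x \<in> ?C \<and> y \<in> ?C}"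
  let ?\<beta> = "agree \<tau> M {quad x x z z | x z. x \<in> ?C \<and> z \<in> ?C}"
  let ?\<gamma> = "agree \<tau> M {quad x y y u | x y u. x \<in> ?C \<and> y \<in> ?C \<and> u \<in> ?C}"
  have inv_step: "inv q" if p: "inv p" and pq: "(p, q) \<in> ?\<gamma> \<union> (?\<beta> \<inter> ?\<alpha>)" for p q
  proof -
    have q: "q \<in> carrier ?F"
      using pq by (auto simp: agree_def)
    \<comment> \<open>Both kinds of link preserve Day's identity: a \<gamma>-link by taking
      \<open>u = x\<close>, the other kind through \<alpha>.\<close>
    have "p (quad x y y x) = q (quad x y y x)" if "x \<in> ?C" "y \<in> ?C" for x y
      using pq that unfolding agree_def by blast
    then have q_day: "\<forall>x\<in>?C. \<forall>y\<in>?C. q (quad x y y x) = x"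
      using p by (simp add: inv_def)
    have ap: "(a, p (quad a a c c)) \<in> \<delta>"
      using p by (simp add: inv_def)
    have "(a, q (quad a a c c)) \<in> \<delta>"
      using pq
    proof
      assume "(p, q) \<in> ?\<gamma>"
      then have "p (quad a b b c) = q (quad a b b c)"
        using ac b unfolding agree_def by blast
      moreover have "(p (quad a a c c), p (quad a b b c)) \<in> \<delta>"
        using inv_mid p by (simp add: inv_def)
      ultimately show ?thesis
        using ap inv_mid[OF q q_day] ConD(4,5)[OF \<delta>] by metis
    next
      assume "(p, q) \<in> ?\<beta> \<inter> ?\<alpha>"
      then have "p (quad a a c c) = q (quad a a c c)"
        using ac unfolding agree_def by blast
      then show ?thesis
        using ap by simp
    qed
    then show ?thesis
      using q q_day by (simp add: inv_def)
  qed
  have init: "inv (term_op M (Var (Inl True)))"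
    using ac ConD(3)[OF \<delta>] by (auto simp: inv_def clone_alg_def term_op_def range_quad)
  have "inv q" if "(term_op M (Var (Inl True)), q) \<in> (?\<gamma> \<union> (?\<beta> \<inter> ?\<alpha>))\<^sup>+" for q
    using that
  proof (induction rule: trancl_induct)
    case (base q)
    then show ?case by (rule inv_step[OF init])
  next
    case (step p q)
    show ?case by (rule inv_step[OF step.IH step.hyps(2)])
  qed
  from this[OF day_chain[OF E cm M]] have "inv (term_op M (Var (Inr False)))" .
  then show ?thesis
    using ac by (simp add: inv_def term_op_def range_quad)
qed

section \<open>Centrality\<close>

lemma centralizesD:
  fixes t :: "('s, nat + nat) trm"
  assumes "centralizes \<tau> M \<alpha> \<beta> \<delta>" "wf_trm \<tau> t" "\<forall>i. (a i, b i) \<in> \<alpha>" "\<forall>j. (c j, d j) \<in> \<beta>"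
    and "(eval M (case_sum a c) t, eval M (case_sum a d) t) \<in> \<delta>"
  shows "(eval M (case_sum b c) t, eval M (case_sum b d) t) \<in> \<delta>"
  using assms unfolding centralizes_def by blast

text \<open>Applying \<open>m\<close> to the matrices \<open>[[x, x], [x, x]]\<close>, \<open>[[x, y], [x, y]]\<close>, \<open>[[x, y], [z, u]]\<close>,
  \<open>[[x, x], [z, z]]\<close>, all of them instances of \<open>t\<close>, gives a matrix with constant first row. The
  variables are duplicated, as in each matrix either tuple may be held fixed.\<close>

lemma centralizes_day_term:
  fixes M :: "('s, 'a) algebra" and t :: "('s, nat + nat) trm" and p q r s :: "nat \<Rightarrow> 'a"
  assumes M: "is_algebra \<tau> M" and con: "\<alpha> \<in> Con \<tau> M" "\<beta> \<in> Con \<tau> M" "\<delta> \<in> Con \<tau> M"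
    and C: "centralizes \<tau> M \<alpha> \<beta> \<delta>" and m: "day_term \<tau> M m" and t: "wf_trm \<tau> t"
    and pq: "\<And>i. (p i, q i) \<in> \<alpha>" and rs: "\<And>j. (r j, s j) \<in> \<beta>"
  defines "T \<equiv> \<lambda>p r. eval M (case_sum p r) t"
  shows "(eval M (quad (T p r) (T p r) (T q r) (T q r)) m,
    eval M (quad (T p r) (T p s) (T q s) (T q r)) m) \<in> \<delta>"
proof -
  \<comment> \<open>Two tuples are interleaved into one, the first at even and the second at odd
    positions. The parities \<open>i\<close> and \<open>j\<close> in \<open>ren i j\<close> then
    select which tuple each variable block of \<open>t\<close> reads.\<close>
  define dup where "dup u w n = (if even n then u (n div 2) else w (n div 2))"
    for u w :: "nat \<Rightarrow> 'a" and n
  define ren where "ren i j =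
    subst (case_sum (\<lambda>n. Var (Inl (2 * n + i))) (\<lambda>n. Var (Inr (2 * n + j)))) t" for i j :: nat
  define big where
    "big = subst (case_sum (case_bool (ren 1 1) (ren 1 0)) (case_bool (ren 0 0) (ren 0 1))) m"
  have big_wf: "wf_trm \<tau> big"
    unfolding big_def ren_def using m t
    by (intro wf_subst) (auto simp: day_term_def intro!: wf_subst split: sum.splits bool.splits)
  \<comment> \<open>Parity 1 reads the tuples \<open>p\<close> and \<open>r\<close>, which stay
    fixed; parity 0 reads \<open>u\<close> and \<open>w\<close>, which range over \<open>p\<close>,
    \<open>q\<close> and over \<open>r\<close>, \<open>s\<close>.\<close>
  have ev: "eval M (case_sum (dup u p) (dup w r)) big = eval M (quad (T p r) (T p w) (T u w) (T u r)) m"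
    for u w
  proof -
    let ?v = "case_sum (dup u p) (dup w r)"
    have dup: "(\<lambda>n. dup u w (2 * n)) = u" "(\<lambda>n. dup u w (Suc (2 * n))) = w" for u w
      by (auto simp: dup_def)
    have ren: "eval M ?v (ren i j) = T (\<lambda>n. dup u p (2 * n + i)) (\<lambda>n. dup w r (2 * n + j))" for i j
      unfolding ren_def T_def eval_subst
      by (rule arg_cong[where f = "\<lambda>v. eval M v t"]) (auto split: sum.splits)
    show ?thesis
      unfolding big_def eval_subst
      by (rule arg_cong[where f = "\<lambda>v. eval M v m"])
        (auto simp: ren dup fun_eq_iff split: sum.splits bool.splits)
  qed
  have carr: "p i \<in> carrier M" "q i \<in> carrier M" "r i \<in> carrier M" "s i \<in> carrier M" for i
    using pq rs ConD(2)[OF con(1)] ConD(2)[OF con(2)] by blast+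
  have T: "T p r \<in> carrier M" "T p s \<in> carrier M"
    unfolding T_def using carr by (auto intro!: eval_carrier[OF M _ t] split: sum.splits)
  \<comment> \<open>With \<open>u = p\<close> the four arguments of \<open>m\<close> have the
    pattern x, y, y, x, so Day's identity makes both entries of this row equal to
    \<open>T p r\<close>.\<close>
  have "(eval M (case_sum (dup p p) (dup r r)) big, eval M (case_sum (dup p p) (dup s r)) big) \<in> \<delta>"
    unfolding ev using m T ConD(3)[OF con(3)] by (simp add: day_term_def)
  moreover have "\<forall>i. (dup p p i, dup q p i) \<in> \<alpha>"
    using pq carr ConD(3)[OF con(1)] by (simp add: dup_def)
  moreover have "\<forall>j. (dup r r j, dup s r j) \<in> \<beta>"
    using rs carr ConD(3)[OF con(2)] by (simp add: dup_def)
  ultimately have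
    "(eval M (case_sum (dup q p) (dup r r)) big, eval M (case_sum (dup q p) (dup s r)) big) \<in> \<delta>"
    using centralizesD[OF C big_wf, of "dup p p" "dup q p" "dup r r" "dup s r"] by blast
  then show ?thesis
    unfolding ev .
qed

text \<open>Symmetry and monotonicity come together. Centrality modulo \<delta> enters only through
  the pairs that \<open>centralizes_day_term\<close> places in \<delta>. These pairs also lie in
  \<open>\<delta>'\<close>, and there \<open>day_terms_collapse\<close> needs nothing more.\<close>

lemma centralizes_swap_mono:
  fixes M :: "('s, 'a) algebra"
  assumes E: "wf_equations \<tau> E" and cm: "congruence_modular \<tau> E" and M: "in_class \<tau> E M"
    and con: "\<alpha> \<in> Con \<tau> M" "\<beta> \<in> Con \<tau> M" "\<delta> \<in> Con \<tau> M" "\<delta>' \<in> Con \<tau> M"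
    and C: "centralizes \<tau> M \<alpha> \<beta> \<delta>" and \<delta>: "\<delta> \<subseteq> \<delta>'"
  shows "centralizes \<tau> M \<beta> \<alpha> \<delta>'"
  unfolding centralizes_def
proof (intro allI impI)
  fix t :: "('s, nat + nat) trm" and a b c d
  assume t: "wf_trm \<tau> t" and ab: "\<forall>i. (a i, b i) \<in> \<beta>" and cd: "\<forall>j. (c j, d j) \<in> \<alpha>"
    and \<delta>': "(eval M (case_sum a c) t, eval M (case_sum a d) t) \<in> \<delta>'"
  have alg: "is_algebra \<tau> M"
    using M by (simp add: in_class_def)
  \<comment> \<open>The two blocks of variables are exchanged, since \<alpha> now governs the second
    tuple of \<open>t\<close>.\<close>
  define t' where "t' = subst (case_sum (\<lambda>i. Var (Inr i)) (\<lambda>j. Var (Inl j))) t"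
  have t': "wf_trm \<tau> t'" "eval M (case_sum p r) t' = eval M (case_sum r p) t" for p r
    unfolding t'_def eval_subst
    by (auto intro!: wf_subst t arg_cong[where f = "\<lambda>v. eval M v t"] split: sum.splits)
  have carr: "b i \<in> carrier M" "c i \<in> carrier M" "d i \<in> carrier M" for i
    using ab cd ConD(2)[OF con(1)] ConD(2)[OF con(2)] by blast+
  show "(eval M (case_sum b c) t, eval M (case_sum b d) t) \<in> \<delta>'"
  \<comment> \<open>The given pair, with first tuple \<open>a\<close>, supplies the two middle
    arguments; the wanted pair, with first tuple \<open>b\<close>, supplies the outer ones.\<close>
  proof (rule day_terms_collapse[OF E cm M con(4) _ _ \<delta>'])
    show "eval M (case_sum b c) t \<in> carrier M" "eval M (case_sum b d) t \<in> carrier M"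
      using carr by (auto intro!: eval_carrier[OF alg _ t] split: sum.splits)
    fix m assume "day_term \<tau> M m"
    from centralizes_day_term[OF alg con(1-3) C this t'(1), of c d b a]
    show "(eval M (quad (eval M (case_sum b c) t) (eval M (case_sum b c) t)
        (eval M (case_sum b d) t) (eval M (case_sum b d) t)) m,
      eval M (quad (eval M (case_sum b c) t) (eval M (case_sum a c) t)
        (eval M (case_sum a d) t) (eval M (case_sum b d) t)) m) \<in> \<delta>'"
      unfolding t'(2) using ab cd ConD(4)[OF con(2)] \<delta> by blast
  qed
qed

text \<open>Elements related by the join are linked by finitely many steps in \<alpha> or \<delta>.
  Centrality handles an \<alpha>-step; a \<delta>-step in the first tuple moves both values within
  their \<delta>-classes.\<close>

lemma centralizes_join:
  fixes M :: "('s, 'a) algebra"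
  assumes con: "\<alpha> \<in> Con \<tau> M" "\<beta> \<in> Con \<tau> M" "\<delta> \<in> Con \<tau> M" and C: "centralizes \<tau> M \<alpha> \<beta> \<delta>"
  shows "centralizes \<tau> M (Cg \<tau> M (\<alpha> \<union> \<delta>)) \<beta> \<delta>"
  unfolding centralizes_def
proof (intro allI impI)
  fix t :: "('s, nat + nat) trm" and a b c d
  assume t: "wf_trm \<tau> t" and ab: "\<forall>i. (a i, b i) \<in> Cg \<tau> M (\<alpha> \<union> \<delta>)" and cd: "\<forall>j. (c j, d j) \<in> \<beta>"
    and ac: "(eval M (case_sum a c) t, eval M (case_sum a d) t) \<in> \<delta>"
  let ?P = "\<lambda>e. (eval M (case_sum e c) t, eval M (case_sum e d) t) \<in> \<delta>"
  have ab': "(a i, b i) \<in> (\<alpha> \<union> \<delta>)\<^sup>+" for i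
    using Cg_Un_trancl[OF con(1,3)] ab by blast
  have "(\<alpha> \<union> \<delta>)\<^sup>+ \<subseteq> carrier M \<times> carrier M"
    using ConD(2)[OF con(1)] ConD(2)[OF con(3)] by (simp add: trancl_subset_Sigma)
  then have carr: "a i \<in> carrier M" "b i \<in> carrier M" "c i \<in> carrier M" "d i \<in> carrier M" for i
    using ab' cd ConD(2)[OF con(2)] by blast+
  have one: "?P (e(k := y))"
    if "?P (e(k := x))" "(x, y) \<in> \<alpha> \<union> \<delta>" and e: "\<And>i. e i \<in> carrier M" for e k x y
    using that(2)
  proof
    assume "(x, y) \<in> \<alpha>"
    then have "\<forall>i. ((e(k := x)) i, (e(k := y)) i) \<in> \<alpha>"
      using e ConD(3)[OF con(1)] by simp
    then show ?thesis
      using centralizesD[OF C t _ cd that(1)] by blast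
  next
    assume xy: "(x, y) \<in> \<delta>"
    have "(eval M (case_sum (e(k := x)) g) t, eval M (case_sum (e(k := y)) g) t) \<in> \<delta>"
      if "\<And>j. g j \<in> carrier M" for g
      using xy that e ConD(3)[OF con(3)]
      by (intro eval_Con[OF con(3) t]) (auto split: sum.splits)
    from this[of c] this[of d] show ?thesis
      using that(1) carr(3,4) ConD(4,5)[OF con(3)] by metis
  qed
  have many: "?P (e(k := y))"
    if "(x, y) \<in> (\<alpha> \<union> \<delta>)\<^sup>+" "?P (e(k := x))" "\<And>i. e i \<in> carrier M" for e k x y
    using that(1)
  proof (induction rule: trancl_induct)
    case (base y)
    show ?case by (rule one[OF that(2) base that(3)])
  next
    case (step y z)
    show ?case by (rule one[OF step.IH step.hyps(2) that(3)])
  qed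
  \<comment> \<open>The chains from \<open>a i\<close> to \<open>b i\<close> may have different
    lengths, so the entries are replaced one at a time. Finitely many replacements suffice, because
    only finitely many variables occur in \<open>t\<close>.\<close>
  have "?P (\<lambda>i. if i \<in> S then b i else a i)" if "finite S" for S
    using that
  proof induction
    case empty
    have "(\<lambda>i. if i \<in> {} then b i else a i) = a"
      by simp
    then show ?case using ac by (simp only:)
  next
    case (insert k S)
    let ?e = "\<lambda>i. if i \<in> S then b i else a i"
    \<comment> \<open>As \<open>k\<close> is not in \<open>S\<close>, the entry of \<open>?e\<close>
      at \<open>k\<close> is still \<open>a k\<close>, so the chain from \<open>a k\<close> to
      \<open>b k\<close> starts at \<open>?e\<close> itself.\<close>
    have eqs: "?e(k := a k) = ?e" "?e(k := b k) = (\<lambda>i. if i \<in> insert k S then b i else a i)"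
      using insert.hyps by auto
    have "?P (?e(k := b k))"
      by (rule many[OF ab']) (use insert.IH carr in \<open>auto simp only: eqs split: if_split\<close>)
    then show ?case
      unfolding eqs .
  qed
  moreover have "finite (Inl -` set2_trm t)"
    by (simp add: finite_vimageI finite_vars)
  ultimately have "?P (\<lambda>i. if i \<in> Inl -` set2_trm t then b i else a i)"
    by blast
  moreover have "eval M (case_sum (\<lambda>i. if i \<in> Inl -` set2_trm t then b i else a i) g) t =
    eval M (case_sum b g) t" for g
    by (rule eval_vars_cong) (auto split: sum.splits)
  ultimately show "?P b"
    by simp
qed

text \<open>The commutator centralizes modulo itself. Passing up to \<phi> swaps the arguments, so
  \<beta> can be enlarged by \<open>centralizes_join\<close>; a second swap, now modulo \<phi> on
  both sides, brings \<alpha> to the front to be enlarged likewise.\<close>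

lemma centralizes_joins:
  assumes E: "wf_equations \<tau> E" and cm: "congruence_modular \<tau> E" and M: "in_class \<tau> E M"
    and con: "\<alpha> \<in> Con \<tau> M" "\<beta> \<in> Con \<tau> M" "\<phi> \<in> Con \<tau> M" and le: "commutator \<tau> M \<alpha> \<beta> \<subseteq> \<phi>"
  shows "centralizes \<tau> M (Cg \<tau> M (\<alpha> \<union> \<phi>)) (Cg \<tau> M (\<beta> \<union> \<phi>)) \<phi>"
proof -
  have alg: "is_algebra \<tau> M"
    using M by (simp add: in_class_def)
  have \<beta>': "Cg \<tau> M (\<beta> \<union> \<phi>) \<in> Con \<tau> M"
    using ConD(2)[OF con(2)] ConD(2)[OF con(3)] by (intro Cg_Con alg) auto
  note comm = commutator_least[OF alg con(1,2)]
  have "centralizes \<tau> M \<beta> \<alpha> \<phi>"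
    by (rule centralizes_swap_mono[OF E cm M con(1,2) comm(1) con(3) comm(2) le])
  then have "centralizes \<tau> M (Cg \<tau> M (\<beta> \<union> \<phi>)) \<alpha> \<phi>"
    by (rule centralizes_join[OF con(2,1,3)])
  then have "centralizes \<tau> M \<alpha> (Cg \<tau> M (\<beta> \<union> \<phi>)) \<phi>"
    by (rule centralizes_swap_mono[OF E cm M \<beta>' con(1,3,3) _ subset_refl])
  then show ?thesis
    by (rule centralizes_join[OF con(1) \<beta>' con(3)])
qed


section \<open>Surjective morphisms\<close>

lemma pullback_mono: "\<psi> \<subseteq> \<psi>' \<Longrightarrow> pullback M f \<psi> \<subseteq> pullback M f \<psi>'"
  by (auto simp: pullback_def)

lemma pullback_subset_iff:
  assumes "\<pi> ` carrier M = carrier N" "\<psi> \<subseteq> carrier N \<times> carrier N"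
  shows "pullback M \<pi> \<psi> \<subseteq> pullback M \<pi> \<psi>' \<longleftrightarrow> \<psi> \<subseteq> \<psi>'"
proof
  assume sub: "pullback M \<pi> \<psi> \<subseteq> pullback M \<pi> \<psi>'"
  show "\<psi> \<subseteq> \<psi>'"
  proof (rule subrelI)
    fix x y assume xy: "(x, y) \<in> \<psi>"
    then obtain u v where "u \<in> carrier M" "v \<in> carrier M" "x = \<pi> u" "y = \<pi> v"
      using assms by blast
    then show "(x, y) \<in> \<psi>'"
      using xy sub by (auto simp: pullback_def)
  qed
qed (rule pullback_mono)

text \<open>The surjective half of the correspondence theorem, with the image of \<phi> as witness.
  Since \<phi> contains the kernel, membership in the image can be tested on any preimages
  (\<open>mem\<close>); transitivity and compatibility with the operations follow from this.\<close>

lemma Con_above_Ker: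
  assumes M: "is_algebra \<tau> M" and \<pi>: "\<pi> \<in> hom \<tau> M N" and surj: "\<pi> ` carrier M = carrier N"
    and \<phi>: "\<phi> \<in> Con \<tau> M" and ker: "Ker M N \<pi> \<subseteq> \<phi>"
  obtains \<psi> where "\<psi> \<in> Con \<tau> N" "pullback M \<pi> \<psi> = \<phi>"
proof -
  let ?\<psi> = "rel_image \<pi> \<phi>"
  have ker': "(x, y) \<in> \<phi>" if "x \<in> carrier M" "y \<in> carrier M" "\<pi> x = \<pi> y" for x y
  proof -
    have "\<pi> x \<in> carrier N"
      using that(1) surj by blast
    then have "(x, y) \<in> Ker M N \<pi>"
      using that by (simp add: Ker_def pullback_def Id_on_def)
    then show ?thesis
      using ker by blast
  qed
  have mem: "(\<pi> x, \<pi> y) \<in> ?\<psi> \<longleftrightarrow> (x, y) \<in> \<phi>" if xy: "x \<in> carrier M" "y \<in> carrier M" for x y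
  proof
    assume "(\<pi> x, \<pi> y) \<in> ?\<psi>"
    then obtain u v where uv: "(u, v) \<in> \<phi>" "\<pi> x = \<pi> u" "\<pi> y = \<pi> v"
      by (auto simp: rel_image_def)
    then have "(x, u) \<in> \<phi>" "(v, y) \<in> \<phi>"
      using ker' xy ConD(2)[OF \<phi>] by auto
    then show "(x, y) \<in> \<phi>"
      using uv(1) ConD(5)[OF \<phi>] by blast
  qed (auto simp: rel_image_def)
  have sub: "?\<psi> \<subseteq> carrier N \<times> carrier N"
    by (rule rel_image_subset[OF \<pi> \<phi>])
  have pull: "pullback M \<pi> ?\<psi> = \<phi>"
    by (auto simp: pullback_def mem dest: subsetD[OF ConD(2)[OF \<phi>]])
      (auto simp: rel_image_def)
  have "?\<psi> \<in> Con \<tau> N"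
  proof (rule ConI[OF sub])
    show "(x, x) \<in> ?\<psi>" if x: "x \<in> carrier N" for x
    proof -
      obtain u where "u \<in> carrier M" "x = \<pi> u"
        using x surj by blast
      then show ?thesis
        using mem[of u u] ConD(3)[OF \<phi>, of u] by simp
    qed
    show "(y, x) \<in> ?\<psi>" if "(x, y) \<in> ?\<psi>" for x y
      using that ConD(4)[OF \<phi>] by (auto simp: rel_image_def)
    show "(x, z) \<in> ?\<psi>" if xyz: "(x, y) \<in> ?\<psi>" "(y, z) \<in> ?\<psi>" for x y z
    proof -
      obtain u v w where uvw: "x = \<pi> u" "y = \<pi> v" "z = \<pi> w"
        "u \<in> carrier M" "v \<in> carrier M" "w \<in> carrier M"
        using xyz sub surj by blast
      then show ?thesis
        using xyz mem ConD(5)[OF \<phi>, of u v w] by simp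
    qed
    fix g Xs Ys
    assume g: "\<tau> g = Some (length Xs)" and XY: "list_all2 (\<lambda>x y. (x, y) \<in> ?\<psi>) Xs Ys"
    have "Xs \<in> lists (\<pi> ` carrier M)" "Ys \<in> lists (\<pi> ` carrier M)"
      using list_all2_carrier[OF XY sub] surj by auto
    then obtain xs ys where xs: "set xs \<subseteq> carrier M" "Xs = map \<pi> xs"
      and ys: "set ys \<subseteq> carrier M" "Ys = map \<pi> ys"
      by (auto simp: lists_image)
    have "list_all2 (\<lambda>x y. (x, y) \<in> \<phi>) xs ys"
      using XY xs ys mem by (auto simp: list_all2_conv_all_nth subset_iff)
    moreover have g': "\<tau> g = Some (length xs)" "\<tau> g = Some (length ys)"
      using g xs(2) ys(2) list_all2_lengthD[OF XY] by auto
    ultimately have "(oper M g xs, oper M g ys) \<in> \<phi>"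
      using ConD(6)[OF \<phi>] by blast
    then have "(\<pi> (oper M g xs), \<pi> (oper M g ys)) \<in> ?\<psi>"
      by (auto simp: rel_image_def)
    then show "(oper N g Xs, oper N g Ys) \<in> ?\<psi>"
      using \<pi> g' xs ys by (simp add: hom_def)
  qed
  then show thesis
    using pull by (rule that)
qed

lemma hom_eval_case_sum:
  assumes M: "is_algebra \<tau> M" and \<pi>: "\<pi> \<in> hom \<tau> M N" and t: "wf_trm \<tau> t"
    and uv: "\<And>i. u i \<in> carrier M" "\<And>j. v j \<in> carrier M"
  shows "eval M (case_sum u v) t \<in> carrier M"
    and "eval N (case_sum (\<lambda>i. \<pi> (u i)) (\<lambda>j. \<pi> (v j))) t = \<pi> (eval M (case_sum u v) t)"
proof -
  have r: "range (case_sum u v) \<subseteq> carrier M"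
    using uv by (auto split: sum.splits)
  show "eval M (case_sum u v) t \<in> carrier M"
    by (rule eval_carrier[OF M r t])
  have "(\<lambda>x. \<pi> (case_sum u v x)) = case_sum (\<lambda>i. \<pi> (u i)) (\<lambda>j. \<pi> (v j))"
    by (auto split: sum.splits)
  then show "eval N (case_sum (\<lambda>i. \<pi> (u i)) (\<lambda>j. \<pi> (v j))) t = \<pi> (eval M (case_sum u v) t)"
    using hom_eval[OF M \<pi> r t] by simp
qed

lemma centralizes_pullback:
  fixes M :: "('s, 'a) algebra"
  assumes M: "is_algebra \<tau> M" and \<pi>: "\<pi> \<in> hom \<tau> M N" and C: "centralizes \<tau> N \<alpha> \<beta> \<delta>"
  shows "centralizes \<tau> M (pullback M \<pi> \<alpha>) (pullback M \<pi> \<beta>) (pullback M \<pi> \<delta>)"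
  unfolding centralizes_def
proof (intro allI impI)
  fix t :: "('s, nat + nat) trm" and a b c d
  assume t: "wf_trm \<tau> t" and ab: "\<forall>i. (a i, b i) \<in> pullback M \<pi> \<alpha>"
    and cd: "\<forall>j. (c j, d j) \<in> pullback M \<pi> \<beta>"
    and ac: "(eval M (case_sum a c) t, eval M (case_sum a d) t) \<in> pullback M \<pi> \<delta>"
  note ev = hom_eval_case_sum[OF M \<pi> t]
  have carr: "a i \<in> carrier M" "b i \<in> carrier M" "c i \<in> carrier M" "d i \<in> carrier M" for i
    using ab cd by (auto simp: pullback_def)
  have "\<forall>i. (\<pi> (a i), \<pi> (b i)) \<in> \<alpha>" "\<forall>j. (\<pi> (c j), \<pi> (d j)) \<in> \<beta>"
    using ab cd by (auto simp: pullback_def)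
  moreover have "(eval N (case_sum (\<lambda>i. \<pi> (a i)) (\<lambda>j. \<pi> (c j))) t,
      eval N (case_sum (\<lambda>i. \<pi> (a i)) (\<lambda>j. \<pi> (d j))) t) \<in> \<delta>"
    using ac ev carr by (simp add: pullback_def)
  ultimately have "(eval N (case_sum (\<lambda>i. \<pi> (b i)) (\<lambda>j. \<pi> (c j))) t,
      eval N (case_sum (\<lambda>i. \<pi> (b i)) (\<lambda>j. \<pi> (d j))) t) \<in> \<delta>"
    by (rule centralizesD[OF C t])
  then show "(eval M (case_sum b c) t, eval M (case_sum b d) t) \<in> pullback M \<pi> \<delta>"
    using ev carr by (simp add: pullback_def)
qed

text \<open>Tuples of \<open>N\<close> lift entrywise along the surjection, and membership in each
  of the three relations can be tested on the lifts.\<close>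

lemma centralizes_of_pullback:
  fixes M :: "('s, 'a) algebra" and N :: "('s, 'b) algebra"
  assumes M: "is_algebra \<tau> M" and \<pi>: "\<pi> \<in> hom \<tau> M N" and surj: "\<pi> ` carrier M = carrier N"
    and sub: "\<alpha> \<subseteq> carrier N \<times> carrier N" "\<beta> \<subseteq> carrier N \<times> carrier N"
    and C: "centralizes \<tau> M (pullback M \<pi> \<alpha>) (pullback M \<pi> \<beta>) (pullback M \<pi> \<delta>)"
  shows "centralizes \<tau> N \<alpha> \<beta> \<delta>"
  unfolding centralizes_def
proof (intro allI impI)
  fix t :: "('s, nat + nat) trm" and a b c d
  assume t: "wf_trm \<tau> t" and ab: "\<forall>i. (a i, b i) \<in> \<alpha>" and cd: "\<forall>j. (c j, d j) \<in> \<beta>"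
    and ac: "(eval N (case_sum a c) t, eval N (case_sum a d) t) \<in> \<delta>"
  have lift: "\<exists>v. (\<forall>i. v i \<in> carrier M) \<and> u = (\<lambda>i. \<pi> (v i))" if "\<And>i. u i \<in> carrier N"
    for u :: "nat \<Rightarrow> 'b"
  proof -
    have "\<forall>i. \<exists>x. x \<in> carrier M \<and> u i = \<pi> x"
      using that surj by blast
    then show ?thesis
      by (metis ext)
  qed
  have "a i \<in> carrier N" "b i \<in> carrier N" "c i \<in> carrier N" "d i \<in> carrier N" for i
    using ab cd sub by blast+
  then obtain a' b' c' d' where carr: "\<And>i. a' i \<in> carrier M" "\<And>i. b' i \<in> carrier M"
      "\<And>i. c' i \<in> carrier M" "\<And>i. d' i \<in> carrier M"
    and eqs: "a = (\<lambda>i. \<pi> (a' i))" "b = (\<lambda>i. \<pi> (b' i))" "c = (\<lambda>i. \<pi> (c' i))" "d = (\<lambda>i. \<pi> (d' i))"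
    using lift[of a] lift[of b] lift[of c] lift[of d] by auto
  note ev = hom_eval_case_sum[OF M \<pi> t]
  have "\<forall>i. (a' i, b' i) \<in> pullback M \<pi> \<alpha>" "\<forall>j. (c' j, d' j) \<in> pullback M \<pi> \<beta>"
    using ab cd carr by (auto simp: pullback_def eqs)
  moreover have "(eval M (case_sum a' c') t, eval M (case_sum a' d') t) \<in> pullback M \<pi> \<delta>"
    using ac ev carr by (simp add: pullback_def eqs)
  ultimately have "(eval M (case_sum b' c') t, eval M (case_sum b' d') t) \<in> pullback M \<pi> \<delta>"
    by (rule centralizesD[OF C t])
  then show "(eval N (case_sum b c) t, eval N (case_sum b d) t) \<in> \<delta>"
    using ev carr by (simp add: pullback_def eqs)
qed

lemma pullback_Spec_iff:
  assumes E: "wf_equations \<tau> E" and cm: "congruence_modular \<tau> E" and M: "in_class \<tau> E M"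
    and N: "is_algebra \<tau> N" and \<pi>: "\<pi> \<in> hom \<tau> M N" and surj: "\<pi> ` carrier M = carrier N"
    and \<psi>: "\<psi> \<in> Con \<tau> N"
  shows "pullback M \<pi> \<psi> \<in> Spec \<tau> M \<longleftrightarrow> \<psi> \<in> Spec \<tau> N"
proof -
  have alg: "is_algebra \<tau> M"
    using M by (simp add: in_class_def)
  let ?p = "pullback M \<pi>"
  have p: "?p \<theta> \<in> Con \<tau> M" if "\<theta> \<in> Con \<tau> N" for \<theta>
    by (rule pullback_Con[OF alg \<pi> that])
  have p_sub: "?p \<theta> \<subseteq> ?p \<theta>' \<longleftrightarrow> \<theta> \<subseteq> \<theta>'" if "\<theta> \<in> Con \<tau> N" for \<theta> \<theta>'
    by (rule pullback_subset_iff[OF surj ConD(2)[OF that]])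
  have "?p (carrier N \<times> carrier N) = carrier M \<times> carrier M"
    using surj by (auto simp: pullback_def)
  then have full: "?p \<psi> = carrier M \<times> carrier M \<longleftrightarrow> \<psi> = carrier N \<times> carrier N"
    using p_sub[OF Con_full[OF N], of \<psi>] ConD(2)[OF \<psi>] by auto
  show ?thesis
  proof
    assume prime: "?p \<psi> \<in> Spec \<tau> M"
    have "\<alpha> \<subseteq> \<psi> \<or> \<beta> \<subseteq> \<psi>"
      if con: "\<alpha> \<in> Con \<tau> N" "\<beta> \<in> Con \<tau> N" and le: "commutator \<tau> N \<alpha> \<beta> \<subseteq> \<psi>" for \<alpha> \<beta>
    proof -
      note comm = commutator_least[OF N con]
      \<comment> \<open>The pullback of the commutator of \<alpha> and \<beta> is a congruence
        modulo which \<open>?p \<alpha>\<close> centralizes \<open>?p \<beta>\<close>, so it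
        contains the least such congruence.\<close>
      have "commutator \<tau> M (?p \<alpha>) (?p \<beta>) \<subseteq> ?p (commutator \<tau> N \<alpha> \<beta>)"
        by (intro commutator_least(3)[OF alg] p con comm(1) centralizes_pullback[OF alg \<pi> comm(2)])
      also have "\<dots> \<subseteq> ?p \<psi>"
        by (rule pullback_mono[OF le])
      finally have "?p \<alpha> \<subseteq> ?p \<psi> \<or> ?p \<beta> \<subseteq> ?p \<psi>"
        using prime p con unfolding Spec_def by blast
      then show ?thesis
        using p_sub con by simp
    qed
    then show "\<psi> \<in> Spec \<tau> N"
      using \<psi> prime full by (simp add: Spec_def)
  next
    assume prime: "\<psi> \<in> Spec \<tau> N"
    have "\<alpha> \<subseteq> ?p \<psi> \<or> \<beta> \<subseteq> ?p \<psi>"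
      if con: "\<alpha> \<in> Con \<tau> M" "\<beta> \<in> Con \<tau> M" and le: "commutator \<tau> M \<alpha> \<beta> \<subseteq> ?p \<psi>" for \<alpha> \<beta>
    proof -
      have ker: "Ker M N \<pi> \<subseteq> ?p \<psi>"
        unfolding Ker_def using ConD(3)[OF \<psi>] by (intro pullback_mono) (auto simp: Id_on_def)
      \<comment> \<open>An arbitrary congruence of \<open>M\<close> need not contain the kernel, but
        its join with \<open>?p \<psi>\<close> does and hence comes from \<open>N\<close>.\<close>
      have lift: "\<exists>\<gamma>'\<in>Con \<tau> N. ?p \<gamma>' = Cg \<tau> M (\<gamma> \<union> ?p \<psi>)" if "\<gamma> \<in> Con \<tau> M" for \<gamma>
      proof -
        have "Cg \<tau> M (\<gamma> \<union> ?p \<psi>) \<in> Con \<tau> M"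
          using ConD(2)[OF that] ConD(2)[OF p[OF \<psi>]] by (intro Cg_Con alg) auto
        moreover have "Ker M N \<pi> \<subseteq> Cg \<tau> M (\<gamma> \<union> ?p \<psi>)"
          using ker Cg_upper[of "\<gamma> \<union> ?p \<psi>" \<tau> M] by blast
        ultimately show ?thesis
          using Con_above_Ker[OF alg \<pi> surj] by metis
      qed
      obtain \<alpha>' \<beta>' where con': "\<alpha>' \<in> Con \<tau> N" "\<beta>' \<in> Con \<tau> N"
        and eqs: "?p \<alpha>' = Cg \<tau> M (\<alpha> \<union> ?p \<psi>)" "?p \<beta>' = Cg \<tau> M (\<beta> \<union> ?p \<psi>)"
        using lift con by metis
      have "centralizes \<tau> M (?p \<alpha>') (?p \<beta>') (?p \<psi>)"
        unfolding eqs by (rule centralizes_joins[OF E cm M con p[OF \<psi>] le])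
      then have "centralizes \<tau> N \<alpha>' \<beta>' \<psi>"
        by (rule centralizes_of_pullback[OF alg \<pi> surj ConD(2)[OF con'(1)] ConD(2)[OF con'(2)]])
      then have "commutator \<tau> N \<alpha>' \<beta>' \<subseteq> \<psi>"
        by (rule commutator_least(3)[OF N con' \<psi>])
      then have "\<alpha>' \<subseteq> \<psi> \<or> \<beta>' \<subseteq> \<psi>"
        using prime con' unfolding Spec_def by blast
      then have "?p \<alpha>' \<subseteq> ?p \<psi> \<or> ?p \<beta>' \<subseteq> ?p \<psi>"
        using p_sub con' by simp
      then show ?thesis
        unfolding eqs using Cg_upper[of "\<alpha> \<union> ?p \<psi>" \<tau> M] Cg_upper[of "\<beta> \<union> ?p \<psi>" \<tau> M] by blast
    qed
    then show "?p \<psi> \<in> Spec \<tau> M"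
      using p[OF \<psi>] prime full by (simp add: Spec_def)
  qed
qed

section \<open>Canonical projections onto quotients\<close>

definition proj :: "'a rel \<Rightarrow> 'a \<Rightarrow> 'a set" where
  "proj \<theta> x = \<theta> `` {x}"

lemma proj_hom: "\<theta> \<in> Con \<tau> M \<Longrightarrow> proj \<theta> \<in> hom \<tau> M (quotient_alg M \<theta>)"
  using oper_quotient_alg[of \<theta> \<tau> M]
  by (auto simp: hom_def proj_def[abs_def] quotient_alg_def quotientI)

lemma proj_surj: "proj \<theta> ` carrier M = carrier (quotient_alg M \<theta>)"
  by (auto simp: proj_def quotient_alg_def quotient_def)

lemma proj_eq_iff:
  "\<theta> \<in> Con \<tau> M \<Longrightarrow> x \<in> carrier M \<Longrightarrow> y \<in> carrier M \<Longrightarrow> proj \<theta> x = proj \<theta> y \<longleftrightarrow> (x, y) \<in> \<theta>"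
  unfolding proj_def by (rule eq_equiv_class_iff[OF ConD(1)])

lemma Ker_proj:
  assumes "\<theta> \<in> Con \<tau> M"
  shows "Ker M (quotient_alg M \<theta>) (proj \<theta>) = \<theta>"
proof -
  have "Ker M (quotient_alg M \<theta>) (proj \<theta>) = {(x, y) \<in> carrier M \<times> carrier M. proj \<theta> x = proj \<theta> y}"
    unfolding Ker_def proj_surj[symmetric] by (auto simp: pullback_def)
  also have "\<dots> = \<theta>"
    using proj_eq_iff[OF assms] ConD(2)[OF assms] by blast
  finally show ?thesis .
qed

lemma Id_on_Con:
  assumes "is_algebra \<tau> M"
  shows "Id_on (carrier M) \<in> Con \<tau> M"
proof (rule ConI)
  fix g xs ys
  assume g: "\<tau> g = Some (length xs)" and xy: "list_all2 (\<lambda>x y. (x, y) \<in> Id_on (carrier M)) xs ys"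
  have "set xs \<subseteq> carrier M"
    using list_all2_carrier[OF xy Id_on_subset_Times] by simp
  moreover have "xs = ys"
    using xy by (induction rule: list_all2_induct) auto
  ultimately show "(oper M g xs, oper M g ys) \<in> Id_on (carrier M)"
    using assms g by (auto simp: is_algebra_def)
qed auto

section \<open>Lying over for a morphism and for the morphisms it induces on quotients\<close>

theorem proposition7p11:
  fixes \<tau> :: "'s signature" and E :: "'s equations"
    and A :: "('s, 'a) algebra" and B :: "('s, 'b) algebra" and f :: "'a \<Rightarrow> 'b"
  assumes "wf_equations \<tau> E"
    and "congruence_modular \<tau> E"
    and "in_class \<tau> E A" and "in_class \<tau> E B"
    and "f \<in> hom \<tau> A B"
    and "admissible \<tau> A B f"
  shows "(fulfills_LO \<tau> A B f \<longleftrightarrow>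
      (\<forall>\<theta>\<in>Con \<tau> A. fulfills_LO \<tau> (quotient_alg A \<theta>)
         (quotient_alg B (Cg \<tau> B (rel_image f \<theta>))) (induced \<tau> B f \<theta>))) \<and>
    (fulfills_LO \<tau> A B f \<longleftrightarrow>
      fulfills_LO \<tau> (quotient_alg A (Ker A B f))
        (quotient_alg B (Cg \<tau> B (rel_image f (Ker A B f)))) (induced \<tau> B f (Ker A B f)))"
proof -
  note f = assms(5)
  have A: "is_algebra \<tau> A" and B: "is_algebra \<tau> B"
    using assms(3,4) by (simp_all add: in_class_def)
  have f_carrier: "f a \<in> carrier B" if "a \<in> carrier A" for a
    using f that by (auto simp: hom_def)
  define \<chi> where "\<chi> \<theta> = Cg \<tau> B (rel_image f \<theta>)" for \<theta>
  define h where "h \<theta> = induced \<tau> B f \<theta>" for \<theta>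
  let ?A = "\<lambda>\<theta>. quotient_alg A \<theta>" and ?B = "\<lambda>\<theta>. quotient_alg B (\<chi> \<theta>)"
  let ?pA = "\<lambda>\<theta>. pullback A (proj \<theta>)" and ?pB = "\<lambda>\<theta>. pullback B (proj (\<chi> \<theta>))"
  have \<chi>: "\<chi> \<theta> \<in> Con \<tau> B" if "\<theta> \<in> Con \<tau> A" for \<theta>
    unfolding \<chi>_def by (rule Cg_Con[OF B rel_image_subset[OF f that]])
  have h_hom: "h \<theta> \<in> hom \<tau> (?A \<theta>) (?B \<theta>)" if "\<theta> \<in> Con \<tau> A" for \<theta>
    unfolding h_def \<chi>_def by (rule induced_hom[OF A B f that])
  have h_proj: "h \<theta> (proj \<theta> a) = proj (\<chi> \<theta>) (f a)" if "\<theta> \<in> Con \<tau> A" "a \<in> carrier A" for \<theta> a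
    unfolding h_def \<chi>_def proj_def by (rule induced_class[OF B f that])
  have alg_A: "is_algebra \<tau> (?A \<theta>)" and alg_B: "is_algebra \<tau> (?B \<theta>)" if "\<theta> \<in> Con \<tau> A" for \<theta>
    using that by (auto intro: is_algebra_quotient_alg A B \<chi>)
  have Spec_A: "?pA \<theta> \<psi> \<in> Spec \<tau> A \<longleftrightarrow> \<psi> \<in> Spec \<tau> (?A \<theta>)"
    if "\<theta> \<in> Con \<tau> A" "\<psi> \<in> Con \<tau> (?A \<theta>)" for \<theta> \<psi>
    by (rule pullback_Spec_iff[OF assms(1-3) alg_A[OF that(1)] proj_hom[OF that(1)] proj_surj that(2)])
  have Spec_B: "?pB \<theta> \<psi> \<in> Spec \<tau> B \<longleftrightarrow> \<psi> \<in> Spec \<tau> (?B \<theta>)"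
    if "\<theta> \<in> Con \<tau> A" "\<psi> \<in> Con \<tau> (?B \<theta>)" for \<theta> \<psi>
    by (rule pullback_Spec_iff[OF assms(1,2,4) alg_B[OF that(1)] proj_hom[OF \<chi>[OF that(1)]] proj_surj that(2)])
  \<comment> \<open>Both sides pull \<psi> back along the same map, since \<open>h \<theta>\<close>
    after the projection of \<open>A\<close> equals the projection of \<open>B\<close> after
    \<open>f\<close>.\<close>
  have square: "?pA \<theta> (pullback (?A \<theta>) (h \<theta>) \<psi>) = pullback A f (?pB \<theta> \<psi>)"
    if "\<theta> \<in> Con \<tau> A" for \<theta> \<psi>
    using that proj_surj[of \<theta> A] h_proj f_carrier by (auto simp: pullback_def)
  have pA_inj: "\<phi> = \<phi>'"
    if "?pA \<theta> \<phi> = ?pA \<theta> \<phi>'" "\<phi> \<in> Con \<tau> (?A \<theta>)" "\<phi>' \<in> Con \<tau> (?A \<theta>)" for \<theta> \<phi> \<phi>'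
    using that(1) pullback_subset_iff[OF proj_surj ConD(2)[OF that(2)]]
      pullback_subset_iff[OF proj_surj ConD(2)[OF that(3)]] by blast
  have Ker_Con: "Ker A B f \<in> Con \<tau> A"
    unfolding Ker_def by (rule pullback_Con[OF A f Id_on_Con[OF B]])
  have induced_LO: "fulfills_LO \<tau> (?A \<theta>) (?B \<theta>) (h \<theta>)"
    if LO: "fulfills_LO \<tau> A B f" and \<theta>: "\<theta> \<in> Con \<tau> A" for \<theta>
    unfolding fulfills_LO_def admissible_def
  proof (intro conjI ballI impI)
    fix \<psi> assume \<psi>: "\<psi> \<in> Spec \<tau> (?B \<theta>)"
    then have \<psi>': "\<psi> \<in> Con \<tau> (?B \<theta>)"
      by (simp add: Spec_def)
    \<comment> \<open>Admissibility of \<open>h \<theta>\<close> is read off the square: up to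
      \<open>B\<close>, back along the admissible \<open>f\<close>, then down to the quotient of
      \<open>A\<close>.\<close>
    have "?pB \<theta> \<psi> \<in> Spec \<tau> B"
      using Spec_B[OF \<theta> \<psi>'] \<psi> by simp
    then have "pullback A f (?pB \<theta> \<psi>) \<in> Spec \<tau> A"
      using assms(6) by (simp add: admissible_def)
    then show "pullback (?A \<theta>) (h \<theta>) \<psi> \<in> Spec \<tau> (?A \<theta>)"
      using Spec_A[OF \<theta> pullback_Con[OF alg_A[OF \<theta>] h_hom[OF \<theta>] \<psi>']] square[OF \<theta>] by simp
  next
    fix \<phi> assume \<phi>: "\<phi> \<in> Spec \<tau> (?A \<theta>)" and ker: "Ker (?A \<theta>) (?B \<theta>) (h \<theta>) \<subseteq> \<phi>"
    have \<phi>': "\<phi> \<in> Con \<tau> (?A \<theta>)"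
      using \<phi> by (simp add: Spec_def)
    have "Ker A B f \<subseteq> ?pA \<theta> \<phi>"
    proof (rule subrelI)
      fix x y assume "(x, y) \<in> Ker A B f"
      then have xy: "x \<in> carrier A" "y \<in> carrier A" "f x = f y"
        by (auto simp: Ker_def pullback_def)
      then have "h \<theta> (proj \<theta> x) = h \<theta> (proj \<theta> y)" "h \<theta> (proj \<theta> x) \<in> carrier (?B \<theta>)"
        "proj \<theta> x \<in> carrier (?A \<theta>)" "proj \<theta> y \<in> carrier (?A \<theta>)"
        using h_proj[OF \<theta>] proj_surj[of \<theta> A] proj_surj[of "\<chi> \<theta>" B] f_carrier by auto
      then have "(proj \<theta> x, proj \<theta> y) \<in> \<phi>"
        using ker by (auto simp: Ker_def pullback_def Id_on_def)
      then show "(x, y) \<in> ?pA \<theta> \<phi>"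
        using xy by (simp add: pullback_def)
    qed
    moreover have "?pA \<theta> \<phi> \<in> Spec \<tau> A"
      using Spec_A[OF \<theta> \<phi>'] \<phi> by simp
    ultimately obtain \<phi>\<^sub>1 where \<phi>\<^sub>1: "\<phi>\<^sub>1 \<in> Spec \<tau> B" "pullback A f \<phi>\<^sub>1 = ?pA \<theta> \<phi>"
      using LO by (auto simp: fulfills_LO_def)
    have \<phi>\<^sub>1': "\<phi>\<^sub>1 \<in> Con \<tau> B"
      using \<phi>\<^sub>1(1) by (simp add: Spec_def)
    \<comment> \<open>This forces \<open>\<phi>\<^sub>1\<close> to contain the image of \<theta>,
      hence \<open>\<chi> \<theta>\<close>, so that \<open>\<phi>\<^sub>1\<close> descends to the
      quotient of \<open>B\<close>.\<close>
    have "\<theta> \<subseteq> ?pA \<theta> \<phi>"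
    proof (rule subrelI)
      fix x y assume xy: "(x, y) \<in> \<theta>"
      then have carr: "x \<in> carrier A" "y \<in> carrier A"
        using ConD(2)[OF \<theta>] by auto
      then have "proj \<theta> x = proj \<theta> y" "proj \<theta> x \<in> carrier (?A \<theta>)"
        using xy proj_eq_iff[OF \<theta>] proj_surj[of \<theta> A] by auto
      then show "(x, y) \<in> ?pA \<theta> \<phi>"
        using carr ConD(3)[OF \<phi>'] by (simp add: pullback_def)
    qed
    then have "rel_image f \<theta> \<subseteq> \<phi>\<^sub>1"
      using \<phi>\<^sub>1(2) by (auto simp: rel_image_def pullback_def)
    then have "\<chi> \<theta> \<subseteq> \<phi>\<^sub>1"
      unfolding \<chi>_def by (rule Cg_least[OF \<phi>\<^sub>1'])
    then have "Ker B (?B \<theta>) (proj (\<chi> \<theta>)) \<subseteq> \<phi>\<^sub>1"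
      using Ker_proj[OF \<chi>[OF \<theta>]] by simp
    then obtain \<psi> where \<psi>: "\<psi> \<in> Con \<tau> (?B \<theta>)" "?pB \<theta> \<psi> = \<phi>\<^sub>1"
      using Con_above_Ker[OF B proj_hom[OF \<chi>[OF \<theta>]] proj_surj \<phi>\<^sub>1'] by metis
    have "\<psi> \<in> Spec \<tau> (?B \<theta>)"
      using Spec_B[OF \<theta> \<psi>(1)] \<psi>(2) \<phi>\<^sub>1(1) by simp
    moreover have "pullback (?A \<theta>) (h \<theta>) \<psi> = \<phi>"
      using square[OF \<theta>, of \<psi>] \<psi>(2) \<phi>\<^sub>1(2)
      by (intro pA_inj[OF _ pullback_Con[OF alg_A[OF \<theta>] h_hom[OF \<theta>] \<psi>(1)] \<phi>']) simp
    ultimately show "\<exists>\<psi>\<in>Spec \<tau> (?B \<theta>). pullback (?A \<theta>) (h \<theta>) \<psi> = \<phi>"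
      by blast
  qed
  have LO_of_Ker: "fulfills_LO \<tau> A B f" if LO: "fulfills_LO \<tau> (?A (Ker A B f)) (?B (Ker A B f)) (h (Ker A B f))"
    unfolding fulfills_LO_def
  proof (intro conjI ballI impI assms(6))
    let ?\<theta> = "Ker A B f"
    note \<theta> = Ker_Con
    fix \<phi> assume \<phi>: "\<phi> \<in> Spec \<tau> A" and ker: "?\<theta> \<subseteq> \<phi>"
    have "\<phi> \<in> Con \<tau> A" "Ker A (?A ?\<theta>) (proj ?\<theta>) \<subseteq> \<phi>"
      using \<phi> ker Ker_proj[OF \<theta>] by (simp_all add: Spec_def)
    then obtain \<phi>' where \<phi>': "\<phi>' \<in> Con \<tau> (?A ?\<theta>)" "?pA ?\<theta> \<phi>' = \<phi>"
      using Con_above_Ker[OF A proj_hom[OF \<theta>] proj_surj] by metis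
    have "\<phi>' \<in> Spec \<tau> (?A ?\<theta>)"
      using Spec_A[OF \<theta> \<phi>'(1)] \<phi>'(2) \<phi> by simp
    moreover have "Ker (?A ?\<theta>) (?B ?\<theta>) (h ?\<theta>) \<subseteq> \<phi>'"
    proof (rule subrelI)
      fix X Y assume XY: "(X, Y) \<in> Ker (?A ?\<theta>) (?B ?\<theta>) (h ?\<theta>)"
      then have "X \<in> carrier (?A ?\<theta>)" "Y \<in> carrier (?A ?\<theta>)"
        by (auto simp: Ker_def pullback_def)
      then obtain x y where xy: "x \<in> carrier A" "y \<in> carrier A" "X = proj ?\<theta> x" "Y = proj ?\<theta> y"
        unfolding proj_surj[symmetric] by blast
      have "h ?\<theta> X = h ?\<theta> Y"
        using XY by (auto simp: Ker_def pullback_def)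
      then have "(f x, f y) \<in> \<chi> ?\<theta>"
        using xy h_proj[OF \<theta>] proj_eq_iff[OF \<chi>[OF \<theta>]] f_carrier by simp
      \<comment> \<open>The image of the kernel of \<open>f\<close> lies on the diagonal, so nothing
        in \<open>B\<close> is collapsed and the kernel of \<open>h ?\<theta>\<close> consists of
        classes of pairs from \<open>Ker A B f\<close>.\<close>
      moreover have "\<chi> ?\<theta> \<subseteq> Id_on (carrier B)"
        unfolding \<chi>_def
        by (rule Cg_least[OF Id_on_Con[OF B]]) (auto simp: rel_image_def Ker_def pullback_def)
      ultimately have "(x, y) \<in> \<phi>"
        using ker xy(1,2) by (auto simp: Ker_def pullback_def)
      then show "(X, Y) \<in> \<phi>'"
        unfolding \<phi>'(2)[symmetric] xy(3,4) by (simp add: pullback_def)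
    qed
    ultimately obtain \<psi> where \<psi>: "\<psi> \<in> Spec \<tau> (?B ?\<theta>)" "pullback (?A ?\<theta>) (h ?\<theta>) \<psi> = \<phi>'"
      using LO by (auto simp: fulfills_LO_def)
    have "?pB ?\<theta> \<psi> \<in> Spec \<tau> B"
      using Spec_B[OF \<theta>, of \<psi>] \<psi>(1) by (simp add: Spec_def)
    moreover have "pullback A f (?pB ?\<theta> \<psi>) = \<phi>"
      using square[OF \<theta>, of \<psi>] \<psi>(2) \<phi>'(2) by simp
    ultimately show "\<exists>\<phi>\<^sub>1\<in>Spec \<tau> B. pullback A f \<phi>\<^sub>1 = \<phi>"
      by blast
  qed
  show ?thesis
    \<comment> \<open>The cycle closes: (1) gives (2), (2) specializes to (3) because the kernel is
      a congruence, and (3) gives (1).\<close>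
    using induced_LO LO_of_Ker Ker_Con unfolding \<chi>_def h_def by blast
qed

end
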